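(* Let $P,Q$ be nonzero integers with $D=P^2-4Q\neq 0$, such that the Lucas sequences $U=U(P,Q)$, $V=V(P,Q)$ are nondegenerate. Fix a prime $p$ and a positive integer $n$ with $(p,n)=1$, and assume $p\nmid (P,Q)$. Then $M^V_{p^kn}\in\mathbb{Z}_{(p)}$ for all $k\ge1$, except in the following cases: (i) $p=2$ divides $D$, $n=1$, $k=1$; (ii) $p=2$ does not divide $D$, $n=3$, $k=1$; (iii) $p>2$ does not divide $D$ and $n=z_U(p)$ is even. In cases (i) and (ii) one may or may not have $M^V_{2^kn}\in\mathbb{Z}_{(2)}$, and in case (iii) one never has $M^V_{p^kn}\in\mathbb{Z}_{(p)}$. Excluding these exceptions, $M^V_{p^kn}\equiv 1\pmod{p^k}$ for all $k\ge1$, unless: $p=2$ divides $D$, $n=1$, $k=2$, in which case $M^V_4\equiv\pm1\pmod 4$; or $p>2$ and $n=z_U(p)/2$, in which case $M^V_{p^kz_U(p)/2}\equiv\left(\frac{D}{p}\right)p\pmod{p^k}$ for all $k\ge1$, with the stronger congruence $M^V_{p^kz_U(p)/2}\equiv\left(\frac{D}{p}\right)p\pmod{p^{k+1}}$ for all $k\ge1$ if moreover $n=z_U(p)/2$ is odd.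
   Context: For nonzero integers $P,Q$ with $D=P^2-4Q\ne0$, let $\alpha=(P+\sqrt D)/2$, $\beta=(P-\sqrt D)/2$ and define $U_n=(\alpha^n-\beta^n)/(\alpha-\beta)$, $V_n=\alpha^n+\beta^n$. Nondegenerate means $U_n,V_n\ne0$ for all $n\ge1$ (equivalently $\alpha/\beta$ is not a root of unity). Define $M^U_n=\prod_{d\mid n}U_d^{\mu(n/d)}$ and $M^V_n=\prod_{d\mid n}V_d^{\mu(n/d)}$ (rational numbers), $\mu$ the Möbius function. $\mathbb{Z}_{(p)}=\{r\in\mathbb{Q}: v_p(r)\ge0\}$, and congruences modulo $p^k$ are taken in $\mathbb{Z}_{(p)}$. For a prime $p$, $z_U(p)$ is the least $n\ge1$ with $p\mid U_n$. $(P,Q)=\gcd(P,Q)$; $\left(\frac{\cdot}{\cdot}\right)$ is the Kronecker symbol. *)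

theory Defs
  imports Complex_Main "HOL-Number_Theory.Number_Theory"
    "HOL-Computational_Algebra.Squarefree"
begin

definition lucas_D :: "int \<Rightarrow> int \<Rightarrow> int" where
  "lucas_D P Q = P\<^sup>2 - 4 * Q"

definition lucas_alpha :: "int \<Rightarrow> int \<Rightarrow> complex" where
  "lucas_alpha P Q = (of_int P + csqrt (of_int (lucas_D P Q))) / 2"

definition lucas_beta :: "int \<Rightarrow> int \<Rightarrow> complex" where
  "lucas_beta P Q = (of_int P - csqrt (of_int (lucas_D P Q))) / 2"

text \<open>
  The Binet expressions are complex numbers whose values are integers; \<open>lucas_U\<close> and
  \<open>lucas_V\<close> denote these integers. The lemmas \<open>of_int_lucas_U\<close> and \<open>of_int_lucas_V\<close>
  below show that the descriptions are proper (for \<open>U\<close>, when the discriminant is nonzero).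
\<close>

definition lucas_U :: "int \<Rightarrow> int \<Rightarrow> nat \<Rightarrow> int" where
  "lucas_U P Q n = (THE u. of_int u =
     (lucas_alpha P Q ^ n - lucas_beta P Q ^ n) / (lucas_alpha P Q - lucas_beta P Q))"

definition lucas_V :: "int \<Rightarrow> int \<Rightarrow> nat \<Rightarrow> int" where
  "lucas_V P Q n = (THE v. of_int v = lucas_alpha P Q ^ n + lucas_beta P Q ^ n)"

lemma lucas_alpha_plus_beta: "lucas_alpha P Q + lucas_beta P Q = of_int P"
  unfolding lucas_alpha_def lucas_beta_def by (simp flip: add_divide_distrib)

lemma lucas_alpha_times_beta: "lucas_alpha P Q * lucas_beta P Q = of_int Q"
proof -
  have conjugates: "(a + b) / 2 * ((a - b) / 2) = (a\<^sup>2 - b\<^sup>2) / 4" for a b :: complex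
    by (simp add: power2_eq_square algebra_simps)
  have "lucas_alpha P Q * lucas_beta P Q
      = ((of_int P)\<^sup>2 - (csqrt (of_int (lucas_D P Q)))\<^sup>2) / 4"
    unfolding lucas_alpha_def lucas_beta_def by (rule conjugates)
  also have "\<dots> = of_int Q"
    unfolding power2_csqrt by (simp add: lucas_D_def)
  finally show ?thesis .
qed

lemma lucas_alpha_neq_beta:
  assumes "lucas_D P Q \<noteq> 0"
  shows "lucas_alpha P Q \<noteq> lucas_beta P Q"
proof
  assume "lucas_alpha P Q = lucas_beta P Q"
  then have "csqrt (of_int (lucas_D P Q)) = - csqrt (of_int (lucas_D P Q))"
    unfolding lucas_alpha_def lucas_beta_def by (simp only: divide_cancel_right) simp
  moreover have "z = 0" if "z = - z" for z :: complex
    using that by (metis add.right_inverse mult_2 mult_eq_0_iff zero_neq_numeral)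
  ultimately have "csqrt (of_int (lucas_D P Q)) = 0"
    by blast
  then have "(of_int (lucas_D P Q) :: complex) = 0"
    by (metis power2_csqrt zero_power2)
  then show False
    using assms by (simp only: of_int_eq_0_iff)
qed

lemma lucas_power_rec:
  fixes x y :: complex
  assumes "x + y = of_int P" "x * y = of_int Q"
  shows "x ^ Suc (Suc n) = of_int P * x ^ Suc n - of_int Q * x ^ n"
proof -
  have "of_int P * x ^ Suc n - of_int Q * x ^ n = (x + y) * x ^ Suc n - (x * y) * x ^ n"
    by (simp add: assms)
  also have "\<dots> = x ^ Suc (Suc n)"
    by (simp add: algebra_simps)
  finally show ?thesis by simp
qed

lemma lucas_alpha_rec:
  "lucas_alpha P Q ^ Suc (Suc n)
     = of_int P * lucas_alpha P Q ^ Suc n - of_int Q * lucas_alpha P Q ^ n"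
  by (rule lucas_power_rec[OF lucas_alpha_plus_beta lucas_alpha_times_beta])

lemma lucas_beta_rec:
  "lucas_beta P Q ^ Suc (Suc n)
     = of_int P * lucas_beta P Q ^ Suc n - of_int Q * lucas_beta P Q ^ n"
  using lucas_alpha_plus_beta lucas_alpha_times_beta
  by (intro lucas_power_rec[where y = "lucas_alpha P Q"])
     (simp_all only: add.commute[of "lucas_beta P Q"] mult.commute[of "lucas_beta P Q"])

lemma lucas_V_ex: "\<exists>v. of_int v = lucas_alpha P Q ^ n + lucas_beta P Q ^ n"
proof (induction n rule: induct_nat_012)
  case 0
  show ?case by (rule exI[of _ 2]) simp
next
  case 1
  show ?case by (rule exI[of _ P]) (simp add: lucas_alpha_plus_beta)
next
  case (ge2 n)
  then obtain u v where
    u: "of_int u = lucas_alpha P Q ^ n + lucas_beta P Q ^ n" and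
    v: "of_int v = lucas_alpha P Q ^ Suc n + lucas_beta P Q ^ Suc n"
    by blast
  have linear: "p * (a' + b') - q * (a + b) = (p * a' - q * a) + (p * b' - q * b)"
    for p q a b a' b' :: complex
    by (simp add: algebra_simps)
  have "of_int (P * v - Q * u)
      = lucas_alpha P Q ^ Suc (Suc n) + lucas_beta P Q ^ Suc (Suc n)"
    unfolding lucas_alpha_rec lucas_beta_rec of_int_diff of_int_mult u v
    by (rule linear)
  then show ?case by blast
qed

lemma lucas_U_ex:
  assumes "lucas_D P Q \<noteq> 0"
  shows "\<exists>u. of_int u =
    (lucas_alpha P Q ^ n - lucas_beta P Q ^ n) / (lucas_alpha P Q - lucas_beta P Q)"
proof (induction n rule: induct_nat_012)
  case 0
  show ?case by (rule exI[of _ 0]) simp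
next
  case 1
  show ?case by (rule exI[of _ 1]) (use lucas_alpha_neq_beta[OF assms] in simp)
next
  case (ge2 n)
  then obtain u v where
    u: "of_int u = (lucas_alpha P Q ^ n - lucas_beta P Q ^ n)
                     / (lucas_alpha P Q - lucas_beta P Q)" and
    v: "of_int v = (lucas_alpha P Q ^ Suc n - lucas_beta P Q ^ Suc n)
                     / (lucas_alpha P Q - lucas_beta P Q)"
    by blast
  have linear: "p * ((a' - b') / c) - q * ((a - b) / c) = ((p * a' - q * a) - (p * b' - q * b)) / c"
    for p q a b a' b' c :: complex
    by (cases "c = 0") (simp_all add: field_simps)
  have "of_int (P * v - Q * u)
      = (lucas_alpha P Q ^ Suc (Suc n) - lucas_beta P Q ^ Suc (Suc n))
          / (lucas_alpha P Q - lucas_beta P Q)"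
    unfolding lucas_alpha_rec lucas_beta_rec of_int_diff of_int_mult u v by (rule linear)
  then show ?case by blast
qed

lemma of_int_lucas_U:
  assumes "lucas_D P Q \<noteq> 0"
  shows "of_int (lucas_U P Q n) =
    (lucas_alpha P Q ^ n - lucas_beta P Q ^ n) / (lucas_alpha P Q - lucas_beta P Q)"
proof -
  have "\<exists>!u. of_int u =
    (lucas_alpha P Q ^ n - lucas_beta P Q ^ n) / (lucas_alpha P Q - lucas_beta P Q)"
    using lucas_U_ex[OF assms, of n] by (metis of_int_eq_iff)
  then show ?thesis
    unfolding lucas_U_def by (rule theI')
qed

lemma of_int_lucas_V:
  "of_int (lucas_V P Q n) = lucas_alpha P Q ^ n + lucas_beta P Q ^ n"
proof -
  have "\<exists>!v. of_int v = lucas_alpha P Q ^ n + lucas_beta P Q ^ n"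
    using lucas_V_ex[of P Q n] by (metis of_int_eq_iff)
  then show ?thesis
    unfolding lucas_V_def by (rule theI')
qed

definition lucas_nondegenerate :: "int \<Rightarrow> int \<Rightarrow> bool" where
  "lucas_nondegenerate P Q \<longleftrightarrow> (\<forall>n\<ge>1. lucas_U P Q n \<noteq> 0 \<and> lucas_V P Q n \<noteq> 0)"

definition moebius :: "nat \<Rightarrow> int" where
  "moebius n = (if squarefree n then (- 1) ^ card (prime_factors n) else 0)"

definition lucas_MV :: "int \<Rightarrow> int \<Rightarrow> nat \<Rightarrow> rat" where
  "lucas_MV P Q n = (\<Prod>d | d dvd n. of_int (lucas_V P Q d) powi moebius (n div d))"

text \<open>
  The rank of appearance need not exist (it does not when \<open>p\<close> divides \<open>Q\<close> but not \<open>P\<close>);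
  it is then given the value \<open>0\<close>, which is never equal to \<open>n\<close> or \<open>2 * n\<close> for positive \<open>n\<close>.
\<close>

definition rank_U :: "int \<Rightarrow> int \<Rightarrow> nat \<Rightarrow> nat" where
  "rank_U P Q p =
     (if \<exists>n\<ge>1. int p dvd lucas_U P Q n then LEAST n. 1 \<le> n \<and> int p dvd lucas_U P Q n else 0)"

text \<open>For \<open>r \<noteq> 0\<close>; the convention that the valuation of \<open>0\<close> is infinite is built
  into \<open>loc_ring\<close>.\<close>

definition rat_val :: "nat \<Rightarrow> rat \<Rightarrow> int" where
  "rat_val p r = int (multiplicity (int p) (fst (quotient_of r)))
                 - int (multiplicity (int p) (snd (quotient_of r)))"

definition loc_ring :: "nat \<Rightarrow> rat set" where
  "loc_ring p = {r. r = 0 \<or> rat_val p r \<ge> 0}"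

definition loc_cong :: "nat \<Rightarrow> nat \<Rightarrow> rat \<Rightarrow> rat \<Rightarrow> bool" where
  "loc_cong p k r s \<longleftrightarrow>
     r \<in> loc_ring p \<and> s \<in> loc_ring p \<and> (\<exists>t\<in>loc_ring p. r - s = of_nat p ^ k * t)"

definition lucas_setting :: "int \<Rightarrow> int \<Rightarrow> nat \<Rightarrow> nat \<Rightarrow> bool" where
  "lucas_setting P Q p n \<longleftrightarrow>
     P \<noteq> 0 \<and> Q \<noteq> 0 \<and> lucas_D P Q \<noteq> 0 \<and> lucas_nondegenerate P Q \<and>
     prime p \<and> n > 0 \<and> coprime p n \<and> \<not> int p dvd gcd P Q"

definition case_i :: "int \<Rightarrow> int \<Rightarrow> nat \<Rightarrow> nat \<Rightarrow> nat \<Rightarrow> bool" where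
  "case_i P Q p n k \<longleftrightarrow> p = 2 \<and> int p dvd lucas_D P Q \<and> n = 1 \<and> k = 1"

definition case_ii :: "int \<Rightarrow> int \<Rightarrow> nat \<Rightarrow> nat \<Rightarrow> nat \<Rightarrow> bool" where
  "case_ii P Q p n k \<longleftrightarrow> p = 2 \<and> \<not> int p dvd lucas_D P Q \<and> n = 3 \<and> k = 1"

definition case_iii :: "int \<Rightarrow> int \<Rightarrow> nat \<Rightarrow> nat \<Rightarrow> bool" where
  "case_iii P Q p n \<longleftrightarrow>
     p > 2 \<and> \<not> int p dvd lucas_D P Q \<and> n = rank_U P Q p \<and> even (rank_U P Q p)"

definition exceptional :: "int \<Rightarrow> int \<Rightarrow> nat \<Rightarrow> nat \<Rightarrow> nat \<Rightarrow> bool" where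
  "exceptional P Q p n k \<longleftrightarrow> case_i P Q p n k \<or> case_ii P Q p n k \<or> case_iii P Q p n"

definition sign_case :: "int \<Rightarrow> int \<Rightarrow> nat \<Rightarrow> nat \<Rightarrow> nat \<Rightarrow> bool" where
  "sign_case P Q p n k \<longleftrightarrow> p = 2 \<and> int p dvd lucas_D P Q \<and> n = 1 \<and> k = 2"

text \<open>
  Here \<open>n\<close> is half the rank of appearance; the equation avoids truncating division. Only in
  this case, where \<open>p\<close> is odd, does the Kronecker symbol \<open>(D/p)\<close> occur, and at odd primes
  it is by definition the Legendre symbol of the library.
\<close>

definition half_rank_case :: "int \<Rightarrow> int \<Rightarrow> nat \<Rightarrow> nat \<Rightarrow> bool" where
  "half_rank_case P Q p n \<longleftrightarrow> p > 2 \<and> 2 * n = rank_U P Q p"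

end

theory Submission
  imports Defs
begin

text \<open>
  For \<open>n\<close> prime to \<open>p\<close>, \<open>M_{p^k n}\<close> is the product of \<open>R_d powi moebius (n div d)\<close> over
  \<open>d dvd n\<close>, where \<open>R_d = V_{p^k d} / V_{p^{k-1} d}\<close>. If \<open>p\<close> does not divide \<open>V_d\<close>, the Gauss
  congruence \<open>V_{p^k d} \<equiv> V_{p^{k-1} d} (mod p^k)\<close> gives \<open>R_d \<equiv> 1\<close>. In the other case \<open>R_d\<close> is
  a constant \<open>c\<close> independent of \<open>d\<close> times a unit congruent to 1 modulo \<open>p^k\<close>: for odd \<open>p\<close>,
  \<open>c = (D/p) p\<close>, because \<open>V_p(v, q) \<equiv> p (-q)^{(p-1)/2} v (mod v^3)\<close> and
  \<open>-4 Q^d \<equiv> D U_d^2 (mod p)\<close>. The indices \<open>d\<close> of the second kind are the multiples of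
  \<open>h = z_U(p)/2\<close> that are not multiples of \<open>2 h\<close>, so \<open>c\<close> enters \<open>M_{p^k n}\<close> with exponent 1 for
  \<open>n = h\<close>, -1 for \<open>n = 2 h\<close>, and 0 otherwise.
\<close>

section \<open>Lucas sequences and their congruences\<close>

text \<open>The powers of any two numbers with sum \<open>P\<close> and product \<open>Q\<close>
  obey the recurrence of \<open>V\<close>. This frees the formula from the root labelling chosen by
  \<open>csqrt\<close>, which passing to \<open>m\<close>-th powers need not respect.\<close>

lemma lucas_V_of_roots:
  fixes a b :: complex
  assumes "a + b = of_int P" "a * b = of_int Q"
  shows "of_int (lucas_V P Q n) = a ^ n + b ^ n"
proof (induction n rule: induct_nat_012)
  case 0
  then show ?case using of_int_lucas_V[of P Q 0] by simp
next
  case 1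
  then show ?case using of_int_lucas_V[of P Q 1] assms by (simp add: lucas_alpha_plus_beta)
next
  case (ge2 n)
  have "(of_int (lucas_V P Q (Suc (Suc n))) :: complex)
      = of_int P * of_int (lucas_V P Q (Suc n)) - of_int Q * of_int (lucas_V P Q n)"
    unfolding of_int_lucas_V lucas_alpha_rec lucas_beta_rec by (simp add: algebra_simps)
  also have "\<dots> = (of_int P * a ^ Suc n - of_int Q * a ^ n) + (of_int P * b ^ Suc n - of_int Q * b ^ n)"
    unfolding ge2 by (simp add: algebra_simps)
  also have "of_int P * a ^ Suc n - of_int Q * a ^ n = a ^ Suc (Suc n)"
    by (rule lucas_power_rec[symmetric, of _ b]) (use assms in auto)
  also have "of_int P * b ^ Suc n - of_int Q * b ^ n = b ^ Suc (Suc n)"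
    by (rule lucas_power_rec[symmetric, of _ a]) (use assms in \<open>auto simp: add.commute mult.commute\<close>)
  finally show ?case .
qed

section \<open>Recurrences and algebraic identities\<close>

lemma lucas_V_0: "lucas_V P Q 0 = 2"
proof -
  have "(of_int (lucas_V P Q 0) :: complex) = of_int 2"
    unfolding of_int_lucas_V by simp
  then show ?thesis by (simp only: of_int_eq_iff)
qed

lemma lucas_V_1: "lucas_V P Q (Suc 0) = P"
proof -
  have "(of_int (lucas_V P Q (Suc 0)) :: complex) = of_int P"
    unfolding of_int_lucas_V by (simp add: lucas_alpha_plus_beta)
  then show ?thesis by (simp only: of_int_eq_iff)
qed

lemma lucas_V_Suc_Suc:
  "lucas_V P Q (Suc (Suc n)) = P * lucas_V P Q (Suc n) - Q * lucas_V P Q n"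
proof -
  have "(of_int (lucas_V P Q (Suc (Suc n))) :: complex)
      = of_int (P * lucas_V P Q (Suc n) - Q * lucas_V P Q n)"
    unfolding of_int_lucas_V lucas_alpha_rec lucas_beta_rec of_int_diff of_int_mult
    by (simp add: algebra_simps)
  then show ?thesis by (simp only: of_int_eq_iff)
qed

lemmas lucas_V_rec = lucas_V_0 lucas_V_1 lucas_V_Suc_Suc

lemma lucas_U_0:
  assumes "lucas_D P Q \<noteq> 0"
  shows "lucas_U P Q 0 = 0"
proof -
  have "(of_int (lucas_U P Q 0) :: complex) = of_int 0"
    unfolding of_int_lucas_U[OF assms] by simp
  then show ?thesis by (simp only: of_int_eq_iff)
qed

lemma lucas_U_1:
  assumes "lucas_D P Q \<noteq> 0"
  shows "lucas_U P Q (Suc 0) = 1"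
proof -
  have "(of_int (lucas_U P Q (Suc 0)) :: complex) = of_int 1"
    unfolding of_int_lucas_U[OF assms] using lucas_alpha_neq_beta[OF assms] by simp
  then show ?thesis by (simp only: of_int_eq_iff)
qed

lemma lucas_U_Suc_Suc:
  assumes "lucas_D P Q \<noteq> 0"
  shows "lucas_U P Q (Suc (Suc n)) = P * lucas_U P Q (Suc n) - Q * lucas_U P Q n"
proof -
  have "(of_int (lucas_U P Q (Suc (Suc n))) :: complex)
      = of_int (P * lucas_U P Q (Suc n) - Q * lucas_U P Q n)"
    unfolding of_int_lucas_U[OF assms] lucas_alpha_rec lucas_beta_rec of_int_diff of_int_mult
    using lucas_alpha_neq_beta[OF assms] by (simp add: divide_simps) (simp add: algebra_simps)
  then show ?thesis by (simp only: of_int_eq_iff)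
qed

lemmas lucas_U_rec = lucas_U_0 lucas_U_1 lucas_U_Suc_Suc

text \<open>\<open>alpha^m\<close> and \<open>beta^m\<close> have sum \<open>V_m\<close> and product
  \<open>Q^m\<close>. Passing from index \<open>m\<close> to \<open>p * m\<close> thus becomes one
  fixed function \<open>V_p\<close> applied to new parameters, which is how powers of
  \<open>p\<close> in the index are treated one factor at a time.\<close>

lemma lucas_V_mult: "lucas_V P Q (m * n) = lucas_V (lucas_V P Q m) (Q ^ m) n"
proof -
  have "(of_int (lucas_V (lucas_V P Q m) (Q ^ m) n) :: complex)
      = (lucas_alpha P Q ^ m) ^ n + (lucas_beta P Q ^ m) ^ n"
  proof (rule lucas_V_of_roots)
    show "lucas_alpha P Q ^ m + lucas_beta P Q ^ m = of_int (lucas_V P Q m)"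
      by (simp add: of_int_lucas_V)
    show "lucas_alpha P Q ^ m * lucas_beta P Q ^ m = of_int (Q ^ m)"
      by (simp flip: power_mult_distrib add: lucas_alpha_times_beta)
  qed
  also have "\<dots> = of_int (lucas_V P Q (m * n))"
    by (simp add: of_int_lucas_V power_mult)
  finally show ?thesis by (simp only: of_int_eq_iff)
qed

lemma lucas_V_double: "lucas_V P Q (2 * n) = (lucas_V P Q n)\<^sup>2 - 2 * Q ^ n"
  using lucas_V_mult[of P Q n 2]
  by (simp add: mult.commute numeral_2_eq_2 lucas_V_rec power2_eq_square)

lemma lucas_U_double:
  assumes "lucas_D P Q \<noteq> 0"
  shows "lucas_U P Q (2 * n) = lucas_U P Q n * lucas_V P Q n"
proof -
  have *: "(x ^ (2 * n) - y ^ (2 * n)) / c = (x ^ n - y ^ n) / c * (x ^ n + y ^ n)" for x y c :: complex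
    by (simp add: mult.commute[of 2] power_mult power2_eq_square square_diff_square_factored)
  have "(of_int (lucas_U P Q (2 * n)) :: complex) = of_int (lucas_U P Q n * lucas_V P Q n)"
    unfolding of_int_mult of_int_lucas_U[OF assms] of_int_lucas_V by (rule *)
  then show ?thesis by (simp only: of_int_eq_iff)
qed

text \<open>The left side is the product of \<open>U_{n+1} - beta U_n = alpha^n\<close> and
  \<open>U_{n+1} - alpha U_n = beta^n\<close>. In particular, consecutive terms of \<open>U\<close>
  share no prime outside \<open>Q\<close>.\<close>

lemma lucas_U_Suc_quadratic:
  assumes "lucas_D P Q \<noteq> 0"
  shows "(lucas_U P Q (Suc n))\<^sup>2 - P * lucas_U P Q n * lucas_U P Q (Suc n) + Q * (lucas_U P Q n)\<^sup>2
      = Q ^ n"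
proof (induction n)
  case (Suc n)
  show ?case
    unfolding lucas_U_Suc_Suc[OF assms] power_Suc Suc[symmetric]
    by (simp add: power2_eq_square algebra_simps)
qed (simp add: lucas_U_rec[OF assms])

lemma lucas_V_eq_U:
  assumes "lucas_D P Q \<noteq> 0"
  shows "lucas_V P Q n = 2 * lucas_U P Q (Suc n) - P * lucas_U P Q n"
proof (induction n rule: induct_nat_012)
  case (ge2 n)
  show ?case
    unfolding lucas_V_Suc_Suc ge2 lucas_U_Suc_Suc[OF assms] by (simp add: algebra_simps)
qed (simp_all add: lucas_V_rec lucas_U_rec[OF assms])

lemma lucas_V_square:
  assumes "lucas_D P Q \<noteq> 0"
  shows "(lucas_V P Q n)\<^sup>2 = lucas_D P Q * (lucas_U P Q n)\<^sup>2 + 4 * Q ^ n"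
  unfolding lucas_V_eq_U[OF assms] lucas_U_Suc_quadratic[OF assms, symmetric] lucas_D_def
  by (simp add: power2_eq_square algebra_simps)

lemma lucas_U_add:
  assumes "lucas_D P Q \<noteq> 0"
  shows "lucas_U P Q (m + Suc n)
      = lucas_U P Q (Suc m) * lucas_U P Q (Suc n) - Q * lucas_U P Q m * lucas_U P Q n"
proof (induction n rule: induct_nat_012)
  case (ge2 n)
  have "lucas_U P Q (m + Suc (Suc (Suc n)))
      = P * lucas_U P Q (m + Suc (Suc n)) - Q * lucas_U P Q (m + Suc n)"
    by (simp add: lucas_U_Suc_Suc[OF assms])
  also have "\<dots> = lucas_U P Q (Suc m) * (P * lucas_U P Q (Suc (Suc n)) - Q * lucas_U P Q (Suc n))
      - Q * lucas_U P Q m * (P * lucas_U P Q (Suc n) - Q * lucas_U P Q n)"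
    unfolding ge2 by (simp add: algebra_simps)
  finally show ?case
    by (simp only: lucas_U_Suc_Suc[OF assms])
qed (simp_all add: lucas_U_rec[OF assms] algebra_simps)

text \<open>These are the lowest terms of \<open>V_n\<close> as a polynomial in \<open>P\<close>,
  with all higher terms hidden in \<open>A\<close> and \<open>B\<close>; they decide the valuation
  once \<open>P\<close> itself is divisible by the prime. The two parities are proved jointly
  because the recurrence alternates between them.\<close>

lemma lucas_V_odd_expansion:
  "\<exists>A. lucas_V P Q (2 * j) = 2 * (- Q) ^ j + P\<^sup>2 * A"
  "\<exists>B. lucas_V P Q (2 * j + 1) = P * (of_nat (2 * j + 1) * (- Q) ^ j + P\<^sup>2 * B)"
proof (induction j)
  case 0
  { case 1 show ?case by (rule exI[of _ 0]) (simp add: lucas_V_rec) }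
  { case 2 show ?case by (rule exI[of _ 0]) (simp add: lucas_V_rec) }
next
  case (Suc j)
  obtain A B where A: "lucas_V P Q (2 * j) = 2 * (- Q) ^ j + P\<^sup>2 * A"
    and B: "lucas_V P Q (2 * j + 1) = P * (of_nat (2 * j + 1) * (- Q) ^ j + P\<^sup>2 * B)"
    using Suc by blast
  have A': "lucas_V P Q (2 * Suc j)
      = 2 * (- Q) ^ Suc j + P\<^sup>2 * (of_nat (2 * j + 1) * (- Q) ^ j + P\<^sup>2 * B - Q * A)"
    using A B by (simp add: lucas_V_Suc_Suc power2_eq_square algebra_simps)
  have "lucas_V P Q (2 * Suc j + 1) = P * lucas_V P Q (2 * Suc j) - Q * lucas_V P Q (2 * j + 1)"
    by (simp add: lucas_V_Suc_Suc)
  also have "\<dots> = P * (of_nat (2 * Suc j + 1) * (- Q) ^ Suc j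
      + P\<^sup>2 * (of_nat (2 * j + 1) * (- Q) ^ j + P\<^sup>2 * B - Q * A - Q * B))"
    unfolding A' B by (simp add: power2_eq_square algebra_simps)
  finally have B': "lucas_V P Q (2 * Suc j + 1) = \<dots>" .
  { case 1 show ?case using A' by blast }
  { case 2 show ?case using B' by blast }
qed

section \<open>Congruences between Lucas numbers\<close>

lemma lucas_V_cong:
  assumes "[v = v'] (mod m)" "[q = q'] (mod m)"
  shows "[lucas_V v q n = lucas_V v' q' n] (mod m)"
proof (induction n rule: induct_nat_012)
  case (ge2 n)
  then show ?case
    unfolding lucas_V_Suc_Suc by (intro cong_diff cong_mult assms)
qed (simp_all add: lucas_V_rec assms)

text \<open>\<open>(a + b)^p\<close> is expanded twice, with the roots exchanged the second time,
  and the two expansions are added. Each term is then symmetric in the roots: with \<open>r\<close>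
  and \<open>s\<close> the smaller and larger exponent,
  \<open>a^r b^s + a^s b^r = Q^r V_{s-r}\<close>. The factor 2 is the price of not splitting the
  range at its middle.\<close>

lemma lucas_V_binomial:
  fixes P Q :: int
  assumes "p > 0"
  shows "2 * (P ^ p - lucas_V P Q p) = (\<Sum>i\<in>{1..<p}. of_nat (p choose i) *
    (Q ^ min i (p - i) * lucas_V P Q (max i (p - i) - min i (p - i))))"
proof -
  define a b where "a = lucas_alpha P Q" and "b = lucas_beta P Q"
  have ab: "a + b = of_int P" "a * b = of_int Q"
    by (simp_all add: a_def b_def lucas_alpha_plus_beta lucas_alpha_times_beta)
  note V = lucas_V_of_roots[OF ab]
  define f where "f i = of_nat (p choose i) * (a ^ i * b ^ (p - i) + a ^ (p - i) * b ^ i)" for i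
  have "of_int P ^ p = (\<Sum>i\<le>p. of_nat (p choose i) * a ^ i * b ^ (p - i))"
    unfolding ab[symmetric] by (rule binomial_ring)
  moreover have "of_int P ^ p = (\<Sum>i\<le>p. of_nat (p choose i) * b ^ i * a ^ (p - i))"
    unfolding ab[symmetric] add.commute[of a b] by (rule binomial_ring)
  ultimately have "2 * of_int P ^ p = (\<Sum>i\<le>p. f i)"
    unfolding mult_2 f_def distrib_left sum.distrib by (simp only: mult_ac)
  also have "{..p} = insert 0 (insert p {1..<p})"
    using assms by auto
  also have "sum f \<dots> = 2 * (a ^ p + b ^ p) + (\<Sum>i\<in>{1..<p}. f i)"
    using assms by (simp add: f_def)
  finally have "2 * (of_int P ^ p - (a ^ p + b ^ p)) = (\<Sum>i\<in>{1..<p}. f i)"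
    by (simp add: algebra_simps)
  moreover have "f i = of_int (of_nat (p choose i) *
    (Q ^ min i (p - i) * lucas_V P Q (max i (p - i) - min i (p - i))))" if "i \<in> {1..<p}" for i
  proof -
    have sym: "x ^ r * y ^ s + x ^ s * y ^ r = (x * y) ^ r * (x ^ (s - r) + y ^ (s - r))"
      if "r \<le> s" for x y :: complex and r s
    proof -
      obtain t where t: "s = r + t" using le_Suc_ex[OF \<open>r \<le> s\<close>] by blast
      have *: "u * (v * w) + u * z * v = u * v * (z + w)" for u v w z :: complex
        by (simp add: algebra_simps)
      show ?thesis unfolding t power_add power_mult_distrib add_diff_cancel_left' by (rule *)
    qed
    define r s where "r = min i (p - i)" and "s = max i (p - i)"
    have "a ^ i * b ^ (p - i) + a ^ (p - i) * b ^ i = a ^ r * b ^ s + a ^ s * b ^ r"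
      by (cases "i \<le> p - i") (simp_all add: r_def s_def add.commute)
    also have "\<dots> = of_int (Q ^ r * lucas_V P Q (s - r))"
      unfolding of_int_mult of_int_power V ab(2)[symmetric]
      by (rule sym) (simp add: r_def s_def)
    finally show ?thesis
      unfolding f_def r_def s_def by simp
  qed
  ultimately have "(of_int (2 * (P ^ p - lucas_V P Q p)) :: complex)
    = of_int (\<Sum>i\<in>{1..<p}. of_nat (p choose i) *
    (Q ^ min i (p - i) * lucas_V P Q (max i (p - i) - min i (p - i))))"
    by (simp add: V)
  then show ?thesis by (simp only: of_int_eq_iff)
qed

text \<open>In \<open>a^p - b^p = (a - b) * (sum of p terms)\<close> the sum is congruent to
  \<open>p * b^(p-1)\<close> modulo \<open>p\<close>, so it supplies one more factor
  \<open>p\<close>.\<close>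

lemma cong_power_lift:
  fixes a b :: int
  assumes "[a = b] (mod int p ^ j)" "j \<ge> 1"
  shows "[a ^ p = b ^ p] (mod int p ^ Suc j)"
proof -
  have "int p dvd int p ^ j" using assms(2) by (simp add: dvd_power)
  then have ab: "[a = b] (mod int p)"
    using assms(1) cong_dvd_modulus by blast
  have "[(\<Sum>i<p. b ^ (p - Suc i) * a ^ i) = (\<Sum>i<p. b ^ (p - Suc i) * b ^ i)] (mod int p)"
    by (intro cong_sum cong_mult cong_pow ab cong_refl)
  also have "(\<Sum>i<p. b ^ (p - Suc i) * b ^ i) = (\<Sum>i<p. b ^ (p - 1))"
    by (intro sum.cong) (auto simp flip: power_add)
  also have "\<dots> = int p * b ^ (p - 1)" by simp
  also have "[\<dots> = 0] (mod int p)" by (simp add: cong_0_iff)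
  finally have "int p dvd (\<Sum>i<p. b ^ (p - Suc i) * a ^ i)" by (simp add: cong_0_iff)
  moreover have "int p ^ j dvd a - b" using assms(1) by (simp add: cong_iff_dvd_diff)
  ultimately have "int p ^ j * int p dvd (a - b) * (\<Sum>i<p. b ^ (p - Suc i) * a ^ i)"
    by (rule mult_dvd_mono[rotated])
  then show ?thesis
    by (simp add: cong_iff_dvd_diff power_diff_sumr2 mult.commute)
qed

lemma cong_power_prime_power:
  fixes a b :: int
  assumes "[a = b] (mod int p)"
  shows "[a ^ (p ^ j) = b ^ (p ^ j)] (mod int p ^ Suc j)"
proof (induction j)
  case (Suc j)
  then show ?case
    using cong_power_lift[of "a ^ p ^ j" "b ^ p ^ j" p "Suc j"] by (simp flip: power_mult add: mult.commute)
qed (use assms in simp)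

lemma fermat_int:
  assumes "prime p"
  shows "[(a::int) ^ p = a] (mod int p)"
proof -
  have p: "p > 0" using assms by (simp add: prime_gt_0_nat)
  have nat: "[int n ^ p = int n] (mod int p)" for n
  proof (cases "p dvd n")
    case True
    then have "int p dvd int n ^ p" "int p dvd int n" using p by (auto intro: dvd_trans[OF _ dvd_power])
    then show ?thesis
      by (simp add: cong_iff_dvd_diff)
  next
    case False
    then have "[n ^ (p - 1) * n = 1 * n] (mod p)"
      by (intro cong_mult fermat_theorem assms cong_refl)
    then have "[n ^ p = n] (mod p)"
      using p by (simp flip: power_Suc2)
    then show ?thesis
      by (metis cong_int_iff of_nat_power)
  qed
  have "int (nat (a mod int p)) = a mod int p" using p by simp
  then have a: "[a = int (nat (a mod int p))] (mod int p)" by (simp add: cong_def)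
  have "[a ^ p = int (nat (a mod int p)) ^ p] (mod int p)" by (intro cong_pow a)
  also note nat
  also note cong_sym[OF a]
  finally show ?thesis .
qed

text \<open>The middle binomial coefficients are divisible by \<open>p\<close>, so
  \<open>2 V_p = 2 v^p - p G\<close> with \<open>G\<close> an integer polynomial in the parameters.
  This gives the first claim by Fermat. For the second, \<open>v^p\<close> gains a power of
  \<open>p\<close> by lifting and \<open>p G\<close> gains one from its factor \<open>p\<close>. For
  \<open>p = 2\<close> the 2 cannot be cancelled, and \<open>V_2 = v^2 - 2 q\<close> is used
  directly.\<close>

lemma lucas_V_prime_cong:
  assumes "prime p"
  shows "[lucas_V v q p = v] (mod int p)"
    and "\<lbrakk>[v = v'] (mod int p ^ j); [q = q'] (mod int p ^ j); j \<ge> 1\<rbrakk>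
      \<Longrightarrow> [lucas_V v q p = lucas_V v' q' p] (mod int p ^ Suc j)"
proof -
  define c where "c i = int ((p choose i) div p)" for i
  define W where "W v q i = q ^ min i (p - i) * lucas_V v q (max i (p - i) - min i (p - i))" for v q i
  define G where "G v q = (\<Sum>i\<in>{1..<p}. c i * W v q i)" for v q
  have "int (p choose i) = int p * c i" if "i \<in> {1..<p}" for i
  proof -
    have "p dvd (p choose i)" using that assms by (intro dvd_choose_prime) auto
    then show ?thesis by (simp add: c_def flip: of_nat_mult)
  qed
  then have G: "2 * (v ^ p - lucas_V v q p) = int p * G v q" for v q
    using lucas_V_binomial[of p v q] prime_gt_0_nat[OF assms]
    by (simp add: G_def W_def sum_distrib_left mult_ac)
  have G_cong: "[G v q = G v' q'] (mod m)" if "[v = v'] (mod m)" "[q = q'] (mod m)" for v v' q q' m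
    unfolding G_def W_def by (intro cong_sum cong_mult cong_refl cong_pow lucas_V_cong that)
  have coprime: "coprime (int p ^ k) 2" if "p \<noteq> 2" for k
    using assms that by (metis coprime_power_left_iff primes_coprime prime_nat_int_transfer
        of_nat_numeral of_nat_eq_iff two_is_prime_nat)
  show "[lucas_V v q p = v] (mod int p)"
  proof (cases "p = 2")
    case True
    have "even (v\<^sup>2 - 2 * q - v)" by simp
    then show ?thesis
      using True lucas_V_double[of v q 1] by (simp add: lucas_V_rec cong_iff_dvd_diff)
  next
    case False
    have "int p dvd 2 * (v ^ p - lucas_V v q p)" unfolding G by simp
    then have "[v ^ p = lucas_V v q p] (mod int p)"
      using coprime[OF False, of 1]
      by (simp only: cong_iff_dvd_diff coprime_dvd_mult_right_iff power_one_right)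
    with fermat_int[OF assms, of v] show ?thesis
      using cong_sym cong_trans by blast
  qed
  show "[lucas_V v q p = lucas_V v' q' p] (mod int p ^ Suc j)"
    if cong: "[v = v'] (mod int p ^ j)" "[q = q'] (mod int p ^ j)" and j: "j \<ge> 1"
  proof -
    have pow: "[v ^ p = v' ^ p] (mod int p ^ Suc j)"
      by (rule cong_power_lift[OF cong(1) j])
    show ?thesis
    proof (cases "p = 2")
      case True
      have "[2 * q = 2 * q'] (mod int p ^ Suc j)"
        using cong(2) unfolding True
        by (simp only: cong_iff_dvd_diff power_Suc right_diff_distrib[symmetric] of_nat_numeral mult_dvd_mono dvd_refl)
      from cong_diff[OF pow this] have "[v\<^sup>2 - 2 * q = v'\<^sup>2 - 2 * q'] (mod int p ^ Suc j)"
        by (simp only: True)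
      moreover have "lucas_V w r p = w\<^sup>2 - 2 * r" for w r
        using lucas_V_double[of w r 1] by (simp add: True lucas_V_1)
      ultimately show ?thesis by (simp only:)
    next
      case False
      have "int p ^ Suc j dvd int p * G v q - int p * G v' q'"
        using G_cong[OF cong]
        by (simp only: cong_iff_dvd_diff power_Suc right_diff_distrib[symmetric] mult_dvd_mono dvd_refl)
      moreover have "2 * (lucas_V v q p - lucas_V v' q' p)
          = 2 * (v ^ p - v' ^ p) - (int p * G v q - int p * G v' q')"
        unfolding G[symmetric] by (simp only: algebra_simps)
      ultimately have "int p ^ Suc j dvd 2 * (lucas_V v q p - lucas_V v' q' p)"
        using pow by (simp only: cong_iff_dvd_diff dvd_diff dvd_mult)
      then show ?thesis
        using coprime[OF False, of "Suc j"]
        by (simp only: cong_iff_dvd_diff coprime_dvd_mult_right_iff)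
    qed
  qed
qed

text \<open>By induction: the parameters \<open>V_m\<close> and \<open>Q^m\<close> for
  \<open>m = p^(k+1) d\<close> and \<open>m = p^k d\<close> agree modulo \<open>p^(k+1)\<close>, the
  powers of \<open>Q\<close> by a lifted Fermat congruence. Applying \<open>V_p\<close> to both
  pairs raises the agreement by one power.\<close>

lemma lucas_V_gauss:
  assumes "prime p"
  shows "[lucas_V P Q (p ^ Suc k * d) = lucas_V P Q (p ^ k * d)] (mod int p ^ Suc k)"
proof (induction k)
  case 0
  then show ?case
    using lucas_V_prime_cong(1)[OF assms] lucas_V_mult[of P Q d p] by (simp add: mult.commute)
next
  case (Suc k)
  have "[Q ^ (p ^ Suc k * d) = Q ^ (p ^ k * d)] (mod int p ^ Suc k)"
    using cong_power_prime_power[OF fermat_int[OF assms, of "Q ^ d"], of k]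
    by (simp flip: power_mult add: mult_ac)
  from lucas_V_prime_cong(2)[OF assms Suc this]
  show ?case
    unfolding lucas_V_mult[symmetric] by (simp add: mult_ac)
qed

section \<open>Divisibility by a prime and the rank of appearance\<close>

lemma lucas_V_cong_power:
  assumes "prime p" "int p dvd Q" 
  shows "[lucas_V P Q (Suc n) = P ^ Suc n] (mod int p)"
proof -
  have "[lucas_V P Q (Suc n) = lucas_V P 0 (Suc n)] (mod int p)"
    using assms by (intro lucas_V_cong) (auto simp: cong_0_iff)
  also have "lucas_V P 0 (Suc n) = P ^ Suc n"
    by (induction n) (simp_all add: lucas_V_rec)
  finally show ?thesis .
qed

text \<open>Modulo a prime divisor of \<open>Q\<close> one root vanishes and \<open>V_n\<close>
  becomes \<open>P^n\<close>, so such a prime dividing \<open>V_n\<close> would divide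
  \<open>P\<close> as well.\<close>

lemma lucas_V_dvd_imp_not_dvd_Q:
  assumes "prime p" "\<not> int p dvd gcd P Q" "int p dvd lucas_V P Q n" "n > 0"
  shows "\<not> int p dvd Q"
proof
  assume "int p dvd Q"
  moreover obtain m where "n = Suc m" using assms(4) gr0_implies_Suc by blast
  ultimately have "int p dvd P ^ Suc m"
    using lucas_V_cong_power[of p Q P m] assms cong_dvd_iff by blast
  then have "int p dvd P" using assms(1) by (metis prime_dvd_power prime_nat_int_transfer)
  with \<open>int p dvd Q\<close> show False using assms(2) by simp
qed

text \<open>For the rank \<open>z\<close>, the addition formula gives \<open>U_{zq+r}\<close>
  congruent to \<open>U_{zq+1} U_r\<close> modulo \<open>p\<close>. Here \<open>U_{zq+1}\<close> is
  a unit, since by the quadratic identity its square is congruent to \<open>Q^(zq)\<close>. Hence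
  \<open>n\<close> may be replaced by \<open>n mod z\<close>, where minimality of \<open>z\<close>
  decides.\<close>

lemma rank_U_dvd_iff:
  assumes "lucas_D P Q \<noteq> 0" "prime p" "\<not> int p dvd Q" "rank_U P Q p \<noteq> 0"
  shows "int p dvd lucas_U P Q n \<longleftrightarrow> rank_U P Q p dvd n"
proof -
  let ?U = "lucas_U P Q"
  define z where "z = rank_U P Q p"
  have ex: "\<exists>n. 1 \<le> n \<and> int p dvd ?U n" and z_eq: "z = (LEAST n. 1 \<le> n \<and> int p dvd ?U n)"
    using assms(4) unfolding z_def rank_U_def by (auto split: if_splits)
  have z: "z \<ge> 1" "int p dvd ?U z"
    using LeastI_ex[OF ex] by (simp_all add: z_eq)
  have least: "r = 0" if "int p dvd ?U r" "r < z" for r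
    using not_less_Least[of r "\<lambda>n. 1 \<le> n \<and> int p dvd ?U n"] that z_eq by (cases r) auto
  have prime: "prime (int p)" using assms(2) by simp
  obtain y where y: "z = Suc y" using z(1) by (cases z) auto
  have mult: "int p dvd ?U (z * q)" for q
  proof (induction q)
    case (Suc q)
    then show ?case
      using lucas_U_add[OF assms(1), of "z * q" y] z(2) by (simp add: y add.commute)
  qed (simp add: lucas_U_0[OF assms(1)])
  have "int p dvd ?U (z * q + r) \<longleftrightarrow> int p dvd ?U r" for q r
  proof (cases r)
    case 0
    then show ?thesis using mult lucas_U_0[OF assms(1)] by simp
  next
    case (Suc s)
    have "\<not> int p dvd ?U (Suc (z * q))"
    proof
      assume "int p dvd ?U (Suc (z * q))"
      then have "int p dvd Q ^ (z * q)"
        using mult[of q] unfolding lucas_U_Suc_quadratic[OF assms(1), symmetric]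
        by (simp add: power2_eq_square)
      then show False using prime assms(3) prime_dvd_power by blast
    qed
    moreover have "int p dvd Q * ?U (z * q) * ?U s" using mult by simp
    ultimately show ?thesis
      unfolding Suc lucas_U_add[OF assms(1)] using prime
      by (metis dvd_diff_left_iff dvd_mult prime_dvd_mult_iff)
  qed
  from this[of "n div z" "n mod z"] have "int p dvd ?U n \<longleftrightarrow> int p dvd ?U (n mod z)" by simp
  also have "\<dots> \<longleftrightarrow> n mod z = 0"
    using least[of "n mod z"] z(1) lucas_U_0[OF assms(1)] by auto
  finally show ?thesis by (simp add: z_def dvd_eq_mod_eq_0)
qed

text \<open>In \<open>V^2 = D U^2 + 4 Q^n\<close>, a factor \<open>p\<close> common to
  \<open>V\<close> and \<open>D U^2\<close> would divide \<open>4 Q^n\<close>.\<close>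

lemma odd_prime_dvd_lucas_V:
  assumes "lucas_D P Q \<noteq> 0" "prime p" "p > 2" "\<not> int p dvd Q" "int p dvd lucas_V P Q n"
  shows "\<not> int p dvd lucas_U P Q n" "\<not> int p dvd lucas_D P Q"
proof -
  have prime: "prime (int p)" using assms(2) by simp
  have "\<not> int p dvd lucas_D P Q * (lucas_U P Q n)\<^sup>2"
  proof
    assume "int p dvd lucas_D P Q * (lucas_U P Q n)\<^sup>2"
    moreover have "int p dvd (lucas_V P Q n)\<^sup>2" using assms(5) by (simp add: power2_eq_square)
    ultimately have "int p dvd 4 * Q ^ n"
      unfolding lucas_V_square[OF assms(1)] by (simp add: dvd_add_right_iff)
    then have "int p dvd 2 ^ 2 \<or> int p dvd Q ^ n"
      using prime by (simp add: prime_dvd_mult_iff)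
    then have "int p dvd 2 \<or> int p dvd Q"
      using prime prime_dvd_power by blast
    then show False
      using assms(3,4) zdvd_imp_le[of "int p" 2] by auto
  qed
  then show "\<not> int p dvd lucas_U P Q n" "\<not> int p dvd lucas_D P Q"
    by (auto simp: power2_eq_square)
qed

text \<open>Since \<open>U_{2n} = U_n V_n\<close> and an odd \<open>p\<close> cannot divide both
  factors, \<open>p\<close> divides \<open>V_n\<close> precisely when it divides
  \<open>U_{2n}\<close> but not \<open>U_n\<close>.\<close>

lemma odd_prime_dvd_lucas_V_iff:
  assumes "lucas_D P Q \<noteq> 0" "prime p" "p > 2" "\<not> int p dvd gcd P Q" "n > 0"
  shows "int p dvd lucas_V P Q n \<longleftrightarrow>
    rank_U P Q p \<noteq> 0 \<and> \<not> int p dvd Q \<and> rank_U P Q p dvd 2 * n \<and> \<not> rank_U P Q p dvd n"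
proof
  assume V: "int p dvd lucas_V P Q n"
  note Q = lucas_V_dvd_imp_not_dvd_Q[OF assms(2,4) V assms(5)]
  have U: "int p dvd lucas_U P Q (2 * n)"
    using V by (simp add: lucas_U_double[OF assms(1)])
  moreover have "2 * n \<ge> 1" using assms(5) by simp
  ultimately have ex: "\<exists>m\<ge>1. int p dvd lucas_U P Q m" by blast
  have "1 \<le> (LEAST m. 1 \<le> m \<and> int p dvd lucas_U P Q m)"
    using LeastI_ex[of "\<lambda>m. 1 \<le> m \<and> int p dvd lucas_U P Q m"] ex by blast
  then have z: "rank_U P Q p \<noteq> 0"
    using ex by (simp add: rank_U_def)
  show "rank_U P Q p \<noteq> 0 \<and> \<not> int p dvd Q \<and> rank_U P Q p dvd 2 * n \<and> \<not> rank_U P Q p dvd n"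
    using z Q U odd_prime_dvd_lucas_V(1)[OF assms(1-3) Q V]
      rank_U_dvd_iff[OF assms(1,2) Q z] by blast
next
  assume *: "rank_U P Q p \<noteq> 0 \<and> \<not> int p dvd Q \<and> rank_U P Q p dvd 2 * n \<and> \<not> rank_U P Q p dvd n"
  then have "int p dvd lucas_U P Q (2 * n)" "\<not> int p dvd lucas_U P Q n"
    using rank_U_dvd_iff[OF assms(1,2)] by blast+
  then show "int p dvd lucas_V P Q n"
    using assms(2) by (simp add: prime_dvd_mult_iff lucas_U_double[OF assms(1)])
qed

section \<open>Moebius products and principal units\<close>

lemma moebius_prime_mult:
  assumes "prime p" "\<not> p dvd e"
  shows "moebius (p * e) = - moebius e"
proof (cases "squarefree e")
  case True
  then have "e \<noteq> 0" by (metis not_squarefree_0)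
  have "squarefree (p * e)"
    by (rule squarefree_mult_coprime[OF prime_imp_coprime squarefree_prime True]) (use assms in auto)
  moreover have "prime_factors (p * e) = insert p (prime_factors e)"
    using \<open>e \<noteq> 0\<close> assms by (subst prime_factors_product) (auto simp: prime_prime_factors)
  ultimately show ?thesis
    using True assms(2) by (simp add: moebius_def in_prime_factors_iff)
next
  case False
  then show ?thesis using squarefree_multD(2)[of p e] by (auto simp: moebius_def)
qed

lemma squarefree_divisors_prime_power_mult:
  fixes p n k :: nat
  assumes "prime p" "coprime p n" "k \<ge> 1"
  shows "{e. e dvd p ^ k * n \<and> squarefree e}
    = {e. e dvd n \<and> squarefree e} \<union> (*) p ` {e. e dvd n \<and> squarefree e}"
proof (intro equalityI subsetI)
  fix e assume "e \<in> {e. e dvd p ^ k * n \<and> squarefree e}"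
  then have e: "e dvd p ^ k * n" "squarefree e" by auto
  have dvd: "f dvd n" if "f dvd p ^ k * n" "\<not> p dvd f" for f
    using that assms(1) by (metis coprime_commute coprime_dvd_mult_right_iff coprime_power_right_iff
        prime_imp_coprime)
  show "e \<in> {e. e dvd n \<and> squarefree e} \<union> (*) p ` {e. e dvd n \<and> squarefree e}"
  proof (cases "p dvd e")
    case False
    then show ?thesis using dvd e by auto
  next
    case True
    then obtain f where f: "e = p * f" by auto
    have "\<not> p dvd f"
    proof
      assume "p dvd f"
      then have "p ^ 2 dvd e" by (simp add: f power2_eq_square)
      then show False using squarefreeD[OF e(2)] assms(1) by (metis not_prime_unit)
    qed
    moreover have "f dvd p ^ k * n" using e(1) by (simp add: f dvd_mult_right)
    ultimately have "f dvd n" using dvd by blast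
    moreover have "squarefree f" using squarefree_multD(2) e(2) f by blast
    ultimately show ?thesis using f by auto
  qed
next
  fix e assume "e \<in> {e. e dvd n \<and> squarefree e} \<union> (*) p ` {e. e dvd n \<and> squarefree e}"
  then consider "e dvd n" "squarefree e" | f where "e = p * f" "f dvd n" "squarefree f" by auto
  then show "e \<in> {e. e dvd p ^ k * n \<and> squarefree e}"
  proof cases
    case 2
    have "coprime p f" using assms(2) 2(2) by (metis coprime_divisors dvd_refl)
    then have "squarefree e"
      unfolding 2(1) by (rule squarefree_mult_coprime[OF _ squarefree_prime[OF assms(1)] 2(3)])
    moreover have "p dvd p ^ k" using assms(3) by (simp add: dvd_power)
    ultimately show ?thesis using 2 by (auto intro: mult_dvd_mono)
  qed auto
qed

lemma squarefree_divisors_prime_power_mult_disjoint: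
  fixes p n :: nat
  assumes "prime p" "coprime p n"
  shows "{e. e dvd n \<and> squarefree e} \<inter> (*) p ` {e. e dvd n \<and> squarefree e} = {}"
proof -
  have "\<not> p * e dvd n" for e
    using assms by (metis coprime_common_divisor dvd_mult_left dvd_refl not_prime_unit)
  then show ?thesis by blast
qed

text \<open>Only squarefree divisors matter, and these contain \<open>p\<close> at most once, so
  they pair up as \<open>e\<close> and \<open>p * e\<close> with \<open>e\<close> dividing
  \<open>n\<close>. The abstract monoid serves both the additive Moebius sums and the multiplicative
  Lucas products.\<close>

lemma (in comm_monoid_set) divisors_prime_power_mult:
  fixes p n k :: nat
  assumes "prime p" "coprime p n" "k \<ge> 1" "n > 0"
    and neutral: "\<And>e. \<not> squarefree e \<Longrightarrow> g e = \<^bold>1"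
  shows "F g {e. e dvd p ^ k * n} = F (\<lambda>e. g e \<^bold>* g (p * e)) {e. e dvd n}"
proof -
  have pos: "p ^ k * n > 0" using assms(1,4) by (simp add: prime_gt_0_nat)
  let ?S = "{e. e dvd n \<and> squarefree e}"
  have fin: "finite ?S" using assms(4) by simp
  have p0: "p \<noteq> 0" using assms(1) by auto
  have not_sf: "\<not> squarefree (p * e)" if "\<not> squarefree e" for e
    using squarefree_multD(2) that by blast
  have "F g {e. e dvd p ^ k * n} = F g {e. e dvd p ^ k * n \<and> squarefree e}"
    using pos by (intro mono_neutral_right) (auto intro: neutral)
  also have "\<dots> = F g ?S \<^bold>* F g ((*) p ` ?S)"
    unfolding squarefree_divisors_prime_power_mult[OF assms(1-3)]
    by (intro union_disjoint squarefree_divisors_prime_power_mult_disjoint assms fin finite_imageI)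
  also have "F g ((*) p ` ?S) = F (\<lambda>e. g (p * e)) ?S"
    using p0 by (subst reindex) (auto simp: inj_on_def comp_def)
  also have "F g ?S \<^bold>* F (\<lambda>e. g (p * e)) ?S = F (\<lambda>e. g e \<^bold>* g (p * e)) ?S"
    by (simp add: distrib)
  also have "\<dots> = F (\<lambda>e. g e \<^bold>* g (p * e)) {e. e dvd n}"
    using assms(4) by (intro mono_neutral_left) (auto simp: neutral not_sf)
  finally show ?thesis .
qed

text \<open>For \<open>n > 1\<close> a full prime power \<open>q^k\<close> is split off; the terms
  of \<open>e\<close> and \<open>q * e\<close> then cancel.\<close>

lemma sum_moebius_divisors:
  assumes "n > 0"
  shows "(\<Sum>e | e dvd n. moebius e) = (if n = 1 then 1 else 0)"
proof (cases "n = 1")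
  case True
  have "{e. e dvd n} = {1::nat}" using True by auto
  then show ?thesis using True by (simp add: moebius_def)
next
  case False
  then obtain q where q: "prime q" "q dvd n" using prime_factor_nat by blast
  define k where "k = multiplicity q n"
  obtain m where m: "n = q ^ k * m" "\<not> q dvd m"
    using multiplicity_decompose'[of n q] q(1) assms unfolding k_def
    by (metis not_gr_zero not_prime_unit)
  have k: "k \<ge> 1" using m q(2) by (cases k) auto
  have co: "coprime q m" using q(1) m(2) by (simp add: prime_imp_coprime)
  have "(\<Sum>e | e dvd n. moebius e) = (\<Sum>e | e dvd m. moebius e + moebius (q * e))"
    unfolding m(1) using q(1) co k assms m(1)
    by (intro sum.divisors_prime_power_mult) (auto simp: moebius_def)
  also have "\<dots> = 0"
  proof (intro sum.neutral ballI)
    fix e assume "e \<in> {e. e dvd m}"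
    then have "\<not> q dvd e" using m(2) dvd_trans by blast
    then show "moebius e + moebius (q * e) = 0"
      using moebius_prime_mult[OF q(1)] by simp
  qed
  finally show ?thesis using False by simp
qed

lemma bij_betw_codivisors:
  assumes "(n::nat) > 0"
  shows "bij_betw (\<lambda>e. n div e) {e. e dvd n} {e. e dvd n}"
  using assms by (intro bij_betwI[where g = "\<lambda>e. n div e"]) (auto simp: dvd_div_eq_mult div_div_eq_right)

lemma sum_moebius_codivisors:
  assumes "n > 0"
  shows "(\<Sum>d | d dvd n. moebius (n div d)) = (if n = 1 then 1 else 0)"
  using sum.reindex_bij_betw[OF bij_betw_codivisors[OF assms], of moebius] sum_moebius_divisors[OF assms]
  by simp

text \<open>Writing \<open>d = h * e\<close> and \<open>n = h * m\<close> turns this into the full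
  Moebius sum over the divisors of \<open>m\<close>. It later computes the exponent with which a
  common constant enters a Moebius product.\<close>

lemma sum_moebius_codivisors_multiples:
  assumes "n > 0" "h > 0"
  shows "(\<Sum>d | d dvd n \<and> h dvd d. moebius (n div d)) = (if n = h then 1 else 0)"
proof (cases "h dvd n")
  case False
  then have "{d. d dvd n \<and> h dvd d} = {}" using dvd_trans by blast
  moreover have "n \<noteq> h" using False by auto
  ultimately show ?thesis by (simp only: sum.empty if_False)
next
  case True
  then obtain m where m: "n = h * m" by auto
  have "{d. d dvd n \<and> h dvd d} = (*) h ` {e. e dvd m}"
    using assms(2) by (auto simp: m)
  then have "(\<Sum>d | d dvd n \<and> h dvd d. moebius (n div d)) = (\<Sum>e | e dvd m. moebius (m div e))"
    using assms(2) by (simp add: sum.reindex inj_on_def m comp_def)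
  then show ?thesis
    using sum_moebius_codivisors[of m] assms by (simp add: m)
qed

section \<open>Lucas quotients and principal units\<close>

definition lucas_V_quot :: "int \<Rightarrow> int \<Rightarrow> nat \<Rightarrow> nat \<Rightarrow> nat \<Rightarrow> rat" where
  "lucas_V_quot P Q p k d
     = of_int (lucas_V P Q (p ^ k * d)) / of_int (lucas_V P Q (p ^ (k - 1) * d))"

text \<open>Indexed by codivisors, the factors of \<open>e\<close> and \<open>p * e\<close> carry
  opposite Moebius exponents and belong to the indices \<open>p^k d\<close> and
  \<open>p^(k-1) d\<close> with \<open>d = n / e\<close>; together they form one quotient.\<close>

lemma lucas_MV_eq_prod_quot:
  assumes "prime p" "coprime p n" "k \<ge> 1" "n > 0"
  shows "lucas_MV P Q (p ^ k * n) = (\<Prod>d | d dvd n. lucas_V_quot P Q p k d powi moebius (n div d))"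
proof -
  define N where "N = p ^ k * n"
  have N: "N > 0" using assms(1,4) by (simp add: N_def prime_gt_0_nat)
  define g where "g e = (of_int (lucas_V P Q (N div e)) :: rat) powi moebius e" for e
  have "lucas_MV P Q N = (\<Prod>d | d dvd N. g (N div d))"
    unfolding lucas_MV_def g_def using N by (intro prod.cong) (auto simp: div_div_eq_right)
  also have "\<dots> = (\<Prod>e | e dvd N. g e)"
    by (rule prod.reindex_bij_betw[OF bij_betw_codivisors[OF N]])
  also have "\<dots> = (\<Prod>e | e dvd n. g e * g (p * e))"
    unfolding N_def using assms
    by (intro prod.divisors_prime_power_mult) (auto simp: g_def moebius_def)
  also have "\<dots> = (\<Prod>e | e dvd n. lucas_V_quot P Q p k (n div e) powi moebius e)"
  proof (intro prod.cong refl)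
    fix e assume "e \<in> {e. e dvd n}"
    then obtain d where d: "n = e * d" by auto
    have "e > 0" using assms(4) d by (cases e) auto
    have "\<not> p dvd e" using assms(1,2) d by (metis coprime_mult_right_iff coprime_absorb_left not_prime_unit)
    then have moeb: "moebius (p * e) = - moebius e"
      using moebius_prime_mult[OF assms(1)] by simp
    have "p ^ k = p * p ^ (k - 1)" using assms(3) by (cases k) auto
    then have "N div e = p ^ k * d" "N div (p * e) = p ^ (k - 1) * d" "n div e = d"
      using \<open>e > 0\<close> prime_gt_0_nat[OF assms(1)] by (simp_all add: N_def d)
    then show "g e * g (p * e) = lucas_V_quot P Q p k (n div e) powi moebius e"
      unfolding g_def moeb lucas_V_quot_def power_int_divide_distrib power_int_minus_divide by simp
  qed
  also have "\<dots> = (\<Prod>d | d dvd n. lucas_V_quot P Q p k (n div (n div d)) powi moebius (n div d))"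
    by (rule prod.reindex_bij_betw[OF bij_betw_codivisors[OF assms(4)], symmetric])
  also have "\<dots> = (\<Prod>d | d dvd n. lucas_V_quot P Q p k d powi moebius (n div d))"
    using assms(4) by (intro prod.cong) (auto simp: div_div_eq_right)
  finally show ?thesis by (simp only: N_def)
qed

text \<open>For \<open>k >= 1\<close> this is the multiplicative group \<open>1 + p^k Z_(p)\<close>.
  Presenting its members by integer fractions keeps the work in integer congruences, and closure
  under inverses accommodates negative Moebius exponents.\<close>

definition unit_cong :: "nat \<Rightarrow> nat \<Rightarrow> rat \<Rightarrow> bool" where
  "unit_cong p k r \<longleftrightarrow> (\<exists>a b. \<not> int p dvd a \<and> \<not> int p dvd b \<and> [a = b] (mod int p ^ k)
     \<and> r = of_int a / of_int b)"

lemma unit_congI: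
  assumes "\<not> int p dvd b" "[a = b] (mod int p ^ k)" "k \<ge> 1" "r = of_int a / of_int b"
  shows "unit_cong p k r"
proof -
  have "int p dvd int p ^ k" using assms(3) by (simp add: dvd_power)
  then have "\<not> int p dvd a" using assms(1,2) cong_dvd_iff cong_dvd_modulus by blast
  then show ?thesis using assms unfolding unit_cong_def by blast
qed

lemma unit_cong_1: "prime p \<Longrightarrow> unit_cong p k 1"
  unfolding unit_cong_def by (rule exI[of _ 1], rule exI[of _ 1]) (auto simp: not_prime_unit)

lemma unit_cong_mult:
  assumes "prime p" "unit_cong p k r" "unit_cong p k s"
  shows "unit_cong p k (r * s)"
proof -
  obtain a b where ab: "\<not> int p dvd a" "\<not> int p dvd b" "[a = b] (mod int p ^ k)"
    "r = of_int a / of_int b" using assms(2) unfolding unit_cong_def by blast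
  obtain c d where cd: "\<not> int p dvd c" "\<not> int p dvd d" "[c = d] (mod int p ^ k)"
    "s = of_int c / of_int d" using assms(3) unfolding unit_cong_def by blast
  have "\<not> int p dvd a * c" "\<not> int p dvd b * d"
    using ab cd assms(1) by (simp_all add: prime_dvd_mult_iff)
  moreover have "[a * c = b * d] (mod int p ^ k)" using ab cd by (intro cong_mult)
  ultimately show ?thesis
    unfolding unit_cong_def using ab(4) cd(4)
    by (intro exI[of _ "a * c"] exI[of _ "b * d"]) simp
qed

lemma unit_cong_inverse:
  assumes "unit_cong p k r"
  shows "unit_cong p k (inverse r)"
proof -
  obtain a b where "\<not> int p dvd a" "\<not> int p dvd b" "[a = b] (mod int p ^ k)"
    "r = of_int a / of_int b" using assms unfolding unit_cong_def by blast
  then show ?thesis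
    unfolding unit_cong_def by (intro exI[of _ b] exI[of _ a]) (simp add: cong_sym)
qed

lemma unit_cong_power_int:
  assumes "prime p" "unit_cong p k r"
  shows "unit_cong p k (r powi i)"
proof -
  have "unit_cong p k (s ^ j)" if "unit_cong p k s" for s j
    by (induction j) (simp_all add: unit_cong_1 unit_cong_mult that assms(1))
  then show ?thesis
    using assms(2) unit_cong_inverse by (simp add: power_int_def)
qed

lemma unit_cong_prod:
  assumes "prime p" "\<And>x. x \<in> A \<Longrightarrow> unit_cong p k (f x)"
  shows "unit_cong p k (prod f A)"
  using assms(2)
  by (induction A rule: infinite_finite_induct) (simp_all add: unit_cong_1 unit_cong_mult assms(1))

text \<open>\<open>T\<close> collects the indices whose factor carries the constant
  \<open>c\<close>. Dividing it out leaves principal units, while the extracted powers of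
  \<open>c\<close> combine by adding Moebius exponents, possibly negative, whence \<open>c\<close>
  nonzero.\<close>

lemma prod_powi_moebius_unit_cong:
  assumes "prime p" "n > 0" "c \<noteq> 0"
    and "\<And>d. d dvd n \<Longrightarrow> unit_cong p k (f d / (if d \<in> T then c else 1))"
  shows "\<exists>w. unit_cong p k w \<and> (\<Prod>d | d dvd n. f d powi moebius (n div d))
    = c powi (\<Sum>d | d dvd n \<and> d \<in> T. moebius (n div d)) * w"
proof (intro exI conjI)
  define g where "g d = f d / (if d \<in> T then c else 1)" for d
  show "unit_cong p k (\<Prod>d | d dvd n. g d powi moebius (n div d))"
    unfolding g_def using assms by (intro unit_cong_prod unit_cong_power_int) auto
  have fin: "finite {d. d dvd n}" using assms(2) by simp
  have "(\<Prod>d | d dvd n. f d powi moebius (n div d))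
      = (\<Prod>d | d dvd n. (if d \<in> T then c powi moebius (n div d) else 1) * g d powi moebius (n div d))"
    using assms(3) by (intro prod.cong) (auto simp: g_def power_int_divide_distrib)
  also have "\<dots> = (\<Prod>d | d dvd n. if d \<in> T then c powi moebius (n div d) else 1)
      * (\<Prod>d | d dvd n. g d powi moebius (n div d))"
    by (rule prod.distrib)
  also have "(\<Prod>d | d dvd n. if d \<in> T then c powi moebius (n div d) else 1)
      = (\<Prod>d | d dvd n \<and> d \<in> T. c powi moebius (n div d))"
    using prod.inter_restrict[OF fin, of "\<lambda>d. c powi moebius (n div d)" T]
    unfolding Int_def by simp
  also have "\<dots> = c powi (\<Sum>d | d dvd n \<and> d \<in> T. moebius (n div d))"
  proof -
    have *: "(\<Prod>d\<in>A. c powi h d) = c powi sum h A" if "finite A" for h :: "nat \<Rightarrow> int" and A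
      using that by induction (simp_all add: power_int_add assms(3))
    show ?thesis by (rule *) (use fin in simp)
  qed
  finally show "(\<Prod>d | d dvd n. f d powi moebius (n div d))
    = c powi (\<Sum>d | d dvd n \<and> d \<in> T. moebius (n div d)) * (\<Prod>d | d dvd n. g d powi moebius (n div d))" .
qed

section \<open>The localization at p\<close>

text \<open>In the reduced fraction \<open>p\<close> divides at most one of numerator and
  denominator, so a nonnegative valuation means that \<open>p\<close> does not divide the
  denominator. The reduced denominator divides every other one, so any representing fraction may be
  used.\<close>

lemma loc_ring_iff:
  assumes "prime p"
  shows "r \<in> loc_ring p \<longleftrightarrow> (\<exists>a b. \<not> int p dvd b \<and> r = of_int a / of_int b)"
proof -
  obtain c d where q: "quotient_of r = (c, d)" by (metis surj_pair)
  have cd: "r = of_int c / of_int d" "coprime c d" "d > 0"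
    using quotient_of_div[OF q] quotient_of_coprime[OF q] quotient_of_denom_pos[OF q] by auto
  have prime: "prime (int p)" "\<not> is_unit (int p)" using assms by (auto simp: not_prime_unit)
  have "r \<in> loc_ring p \<longleftrightarrow> \<not> int p dvd d"
  proof (cases "c = 0")
    case True
    then have "r = 0" "d = 1" using cd by auto
    then show ?thesis using prime by (simp add: loc_ring_def)
  next
    case False
    then have "r \<noteq> 0" using cd by simp
    then have *: "r \<in> loc_ring p \<longleftrightarrow> multiplicity (int p) d \<le> multiplicity (int p) c"
      by (simp add: loc_ring_def rat_val_def q)
    show ?thesis
    proof (cases "int p dvd d")
      case True
      then have "\<not> int p dvd c" using cd(2) prime by (metis coprime_common_divisor)
      moreover have "multiplicity (int p) d > 0"
        using True cd(3) prime by (simp add: prime_multiplicity_gt_zero_iff)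
      ultimately show ?thesis
        using * True by (simp add: not_dvd_imp_multiplicity_0)
    qed (simp add: * not_dvd_imp_multiplicity_0)
  qed
  also have "\<dots> \<longleftrightarrow> (\<exists>a b. \<not> int p dvd b \<and> r = of_int a / of_int b)"
  proof
    assume "\<exists>a b. \<not> int p dvd b \<and> r = of_int a / of_int b"
    then obtain a b where ab: "\<not> int p dvd b" "r = of_int a / of_int b" by blast
    then have "b \<noteq> 0" by auto
    then have "(of_int (c * b) :: rat) = of_int (a * d)"
      using ab(2) cd(1,3) by (simp add: field_simps)
    then have "c * b = a * d" by (simp only: of_int_eq_iff)
    then have "d dvd b" using cd(2) by (metis coprime_commute coprime_dvd_mult_right_iff dvd_triv_right)
    then show "\<not> int p dvd d" using ab(1) dvd_trans by blast
  qed (use cd(1) in blast)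
  finally show ?thesis .
qed

lemma of_int_in_loc_ring:
  assumes "prime p"
  shows "of_int a \<in> loc_ring p"
proof -
  have "\<not> int p dvd 1" using assms by (auto simp: not_prime_unit)
  moreover have "(of_int a :: rat) = of_int a / of_int 1" by simp
  ultimately show ?thesis using loc_ring_iff[OF assms] by blast
qed

lemma loc_ring_mult:
  assumes "prime p" "r \<in> loc_ring p" "s \<in> loc_ring p"
  shows "r * s \<in> loc_ring p"
proof -
  obtain a b c d where "\<not> int p dvd b" "r = of_int a / of_int b" "\<not> int p dvd d" "s = of_int c / of_int d"
    using assms loc_ring_iff by metis
  then have "\<not> int p dvd b * d" "r * s = of_int (a * c) / of_int (b * d)"
    using assms(1) by (simp_all add: prime_dvd_mult_iff)
  then show ?thesis using loc_ring_iff[OF assms(1)] by blast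
qed

lemma unit_cong_in_loc_ring: "prime p \<Longrightarrow> unit_cong p k w \<Longrightarrow> w \<in> loc_ring p"
  unfolding unit_cong_def by (auto simp: loc_ring_iff)

text \<open>The difference is \<open>e p^j (w - 1)\<close>, so the factor \<open>p^j\<close> adds
  \<open>j\<close> to the precision. The case \<open>j = 1\<close> gives the congruence modulo
  \<open>p^(k+1)\<close> at half the rank.\<close>

lemma loc_cong_unit_cong:
  assumes "prime p" "unit_cong p k w"
  shows "loc_cong p (j + k) (of_int (e * int p ^ j) * w) (of_int (e * int p ^ j))"
proof -
  obtain a b where ab: "\<not> int p dvd b" "[a = b] (mod int p ^ k)" "w = of_int a / of_int b"
    using assms(2) unfolding unit_cong_def by blast
  obtain t where t: "a - b = int p ^ k * t" using ab(2) by (auto simp: cong_iff_dvd_diff)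
  have "b \<noteq> 0" using ab(1) by auto
  have "w - 1 = of_int (a - b) / of_int b" using ab(3) \<open>b \<noteq> 0\<close> by (simp add: field_simps)
  then have w: "w - 1 = of_nat p ^ k * (of_int t / of_int b)" by (simp add: t)
  have "of_int (e * int p ^ j) * w - of_int (e * int p ^ j) = of_int (e * int p ^ j) * (w - 1)"
    by (simp add: algebra_simps)
  also have "\<dots> = of_nat p ^ (j + k) * (of_int (e * t) / of_int b)"
    unfolding w by (simp add: power_add)
  finally have eq: "of_int (e * int p ^ j) * w - of_int (e * int p ^ j)
    = of_nat p ^ (j + k) * (of_int (e * t) / of_int b)" .
  moreover have "of_int (e * t) / of_int b \<in> loc_ring p"
    using ab(1) loc_ring_iff[OF assms(1)] by blast
  ultimately show ?thesis
    unfolding loc_cong_def using assms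
    by (blast intro: loc_ring_mult of_int_in_loc_ring unit_cong_in_loc_ring)
qed

lemma loc_cong_mono:
  assumes "prime p" "loc_cong p k r s" "j \<le> k"
  shows "loc_cong p j r s"
proof -
  obtain t where t: "t \<in> loc_ring p" "r - s = of_nat p ^ k * t"
    using assms(2) unfolding loc_cong_def by blast
  have "r - s = of_nat p ^ j * (of_int (int p ^ (k - j)) * t)"
    using t(2) assms(3) by (simp flip: power_add mult.assoc)
  moreover have "of_int (int p ^ (k - j)) * t \<in> loc_ring p"
    by (intro loc_ring_mult of_int_in_loc_ring assms t)
  ultimately show ?thesis using assms(2) unfolding loc_cong_def by blast
qed

section \<open>Quotients of Lucas numbers at consecutive powers of a prime\<close>

lemma prime_not_dvd_lucas_V_mult_power:
  assumes "prime p" "\<not> int p dvd lucas_V P Q d"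
  shows "\<not> int p dvd lucas_V P Q (p ^ j * d)"
proof (induction j)
  case (Suc j)
  have "int p dvd int p ^ Suc j" by simp
  with lucas_V_gauss[OF assms(1)] have "[lucas_V P Q (p ^ Suc j * d) = lucas_V P Q (p ^ j * d)] (mod int p)"
    by (rule cong_dvd_modulus)
  then show ?case using Suc cong_dvd_iff by blast
qed (use assms in simp)

lemma lucas_V_quot_unit_cong:
  assumes "prime p" "\<not> int p dvd lucas_V P Q d" "k \<ge> 1"
  shows "unit_cong p k (lucas_V_quot P Q p k d)"
proof -
  obtain j where j: "k = Suc j" using assms(3) by (cases k) auto
  show ?thesis
    unfolding lucas_V_quot_def
    by (rule unit_congI[OF prime_not_dvd_lucas_V_mult_power[OF assms(1,2), of "k - 1"] _ assms(3) refl])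
       (use lucas_V_gauss[OF assms(1), of P Q j d] in \<open>simp add: j\<close>)
qed

section \<open>Quotients at odd primes\<close>

lemma fermat_int_not_dvd:
  assumes "prime p" "\<not> int p dvd a"
  shows "[a ^ (p - 1) = 1] (mod int p)"
proof -
  have "a ^ p = a * a ^ (p - 1)"
    using prime_gt_0_nat[OF assms(1)] by (simp flip: power_Suc)
  then have "int p dvd a * (a ^ (p - 1) - 1)"
    using fermat_int[OF assms(1), of a] by (simp add: cong_iff_dvd_diff algebra_simps)
  then show ?thesis
    using assms by (simp add: prime_dvd_mult_iff cong_iff_dvd_diff)
qed

text \<open>Since \<open>V_d\<close> vanishes modulo \<open>p\<close>, \<open>-4 Q^d\<close> is
  congruent to \<open>D U_d^2\<close>. In its \<open>(p-1)/2\<close>-th power, Fermat removes the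
  powers of 2 and of \<open>U_d\<close>, and Euler's criterion evaluates the power of
  \<open>D\<close>.\<close>

lemma Legendre_cong_of_dvd_lucas_V:
  assumes "lucas_D P Q \<noteq> 0" "prime p" "p = 2 * j + 1" "\<not> int p dvd Q" "int p dvd lucas_V P Q d"
  shows "[(- (Q ^ d)) ^ j = Legendre (lucas_D P Q) (int p)] (mod int p)"
proof -
  have p2: "p > 2" using assms(3) prime_ge_2_nat[OF assms(2)] by presburger
  have j: "p - 1 = 2 * j" "(p - 1) div 2 = j" using assms(3) by simp_all
  let ?U = "lucas_U P Q d" and ?D = "lucas_D P Q"
  have U: "\<not> int p dvd ?U"
    using odd_prime_dvd_lucas_V(1)[OF assms(1,2) p2 assms(4,5)] .
  have "\<not> int p dvd 2"
    using p2 zdvd_imp_le[of "int p" 2] by auto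
  then have "[2 ^ (2 * j) = 1] (mod int p)"
    using fermat_int_not_dvd[OF assms(2), of 2] j(1) by simp
  then have "[2 ^ (2 * j) * (- (Q ^ d)) ^ j = 1 * (- (Q ^ d)) ^ j] (mod int p)"
    by (intro cong_mult cong_refl)
  then have "[(- (Q ^ d)) ^ j = 2 ^ (2 * j) * (- (Q ^ d)) ^ j] (mod int p)"
    by (simp add: cong_sym)
  also have "2 ^ (2 * j) * (- (Q ^ d)) ^ j = (- 4 * Q ^ d) ^ j"
    by (simp add: power_mult flip: power_mult_distrib)
  also have "[\<dots> = (?D * ?U\<^sup>2) ^ j] (mod int p)"
  proof (rule cong_pow)
    have "int p dvd (lucas_V P Q d)\<^sup>2" using assms(5) by (simp add: power2_eq_square)
    then have "int p dvd - (lucas_V P Q d)\<^sup>2" by simp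
    then show "[- 4 * Q ^ d = ?D * ?U\<^sup>2] (mod int p)"
      unfolding lucas_V_square[OF assms(1)] by (simp add: cong_iff_dvd_diff algebra_simps)
  qed
  also have "(?D * ?U\<^sup>2) ^ j = ?D ^ j * ?U ^ (2 * j)"
    by (simp add: power_mult_distrib power_mult)
  also have "[\<dots> = Legendre ?D (int p) * 1] (mod int p)"
  proof (rule cong_mult)
    show "[?D ^ j = Legendre ?D (int p)] (mod int p)"
      using euler_criterion[OF assms(2) p2, of ?D] j(2) by (simp add: cong_sym)
    show "[?U ^ (2 * j) = 1] (mod int p)"
      using fermat_int_not_dvd[OF assms(2) U] j(1) by simp
  qed
  finally show ?thesis by simp
qed

text \<open>With \<open>v = V_m\<close> and \<open>m = p^(k-1) d\<close>, the expansion of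
  \<open>V_p\<close> gives the quotient as \<open>p (-Q^m)^j + v^2 B\<close>. As \<open>p^k\<close>
  divides \<open>v\<close>, dividing by \<open>p\<close> leaves \<open>(-Q^m)^j\<close> modulo
  \<open>p^k\<close>, which remains to be identified with the Legendre symbol.\<close>

lemma lucas_V_quot_odd_prime:
  assumes "lucas_D P Q \<noteq> 0" "prime p" "p > 2" "\<not> int p dvd Q" "int p dvd lucas_V P Q d"
    and "k \<ge> 1" "lucas_V P Q (p ^ (k - 1) * d) \<noteq> 0"
  shows "unit_cong p k (lucas_V_quot P Q p k d / of_int (Legendre (lucas_D P Q) (int p) * int p))"
proof -
  define \<epsilon> where "\<epsilon> = Legendre (lucas_D P Q) (int p)"
  have "odd p" using prime_odd_nat[OF assms(2)] assms(3) by blast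
  then obtain j where j: "p = 2 * j + 1" by (rule oddE)
  have pos: "int p > 0" using assms(3) by simp
  have "\<not> int p dvd lucas_D P Q"
    using odd_prime_dvd_lucas_V(2)[OF assms(1-5)] .
  then have \<epsilon>: "\<epsilon> = 1 \<or> \<epsilon> = -1"
    by (auto simp: \<epsilon>_def Legendre_def cong_0_iff)
  then have \<epsilon>_unit: "\<not> int p dvd \<epsilon>"
    using assms(2) by (auto simp: not_prime_unit)
  obtain i where i: "k = Suc i" using assms(6) by (cases k) auto
  define m where "m = p ^ i * d"
  define v where "v = lucas_V P Q m"
  have v0: "v \<noteq> 0" using assms(7) by (simp add: v_def m_def i)
  have step: "\<exists>B. lucas_V P Q (p * l) = lucas_V P Q l * (int p * (- (Q ^ l)) ^ j + (lucas_V P Q l)\<^sup>2 * B)" for l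
    using lucas_V_odd_expansion(2)[of "lucas_V P Q l" "Q ^ l" j] lucas_V_mult[of P Q l p]
    unfolding j[symmetric] by (simp add: mult.commute)
  \<comment> \<open>Each multiplication of the index by \<open>p\<close> contributes at least one
    factor \<open>p\<close>, because the bracket in the expansion is divisible by
    \<open>p\<close>.\<close>
  have dvd: "int p ^ Suc i dvd lucas_V P Q (p ^ i * d)" for i
  proof (induction i)
    case (Suc i)
    obtain B where B: "lucas_V P Q (p * (p ^ i * d)) = lucas_V P Q (p ^ i * d) *
      (int p * (- (Q ^ (p ^ i * d))) ^ j + (lucas_V P Q (p ^ i * d))\<^sup>2 * B)"
      using step by blast
    have "int p dvd lucas_V P Q (p ^ i * d)" using Suc by (auto elim: dvd_mult_left)
    then have "int p dvd int p * (- (Q ^ (p ^ i * d))) ^ j + (lucas_V P Q (p ^ i * d))\<^sup>2 * B"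
      by (simp add: power2_eq_square)
    then have "int p ^ Suc i * int p dvd lucas_V P Q (p * (p ^ i * d))"
      unfolding B by (rule mult_dvd_mono[OF Suc])
    then show ?case by (simp add: mult_ac)
  qed (use assms(5) in simp)
  then obtain s where s: "v = int p ^ Suc i * s" unfolding v_def m_def by blast
  obtain B where B: "lucas_V P Q (p * m) = v * (int p * (- (Q ^ m)) ^ j + v\<^sup>2 * B)"
    using step unfolding v_def by blast
  define y where "y = (- (Q ^ m)) ^ j"
  define t where "t = int p ^ i * s\<^sup>2 * B"
  \<comment> \<open>Of the \<open>2 k\<close> factors \<open>p\<close> in \<open>v^2\<close>, one
    matches the constant, \<open>k\<close> form the modulus, and the remaining
    \<open>i = k - 1\<close> go into \<open>t\<close>.\<close>
  have v2: "v\<^sup>2 * B = int p * (int p ^ k * t)"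
    unfolding s t_def i by (simp add: power2_eq_square)
  have "lucas_V P Q (p ^ k * d) = v * (int p * (y + int p ^ k * t))"
    using B unfolding v2 y_def by (simp add: m_def i algebra_simps)
  then have "lucas_V_quot P Q p k d = of_int (int p * (y + int p ^ k * t))"
    using v0 by (simp add: lucas_V_quot_def i flip: v_def m_def)
  then have eq: "lucas_V_quot P Q p k d / of_int (\<epsilon> * int p) = of_int (y + int p ^ k * t) / of_int \<epsilon>"
    using pos \<epsilon> by auto
  have odd: "odd (p ^ i)" using \<open>odd p\<close> by simp
  \<comment> \<open>The Legendre congruence modulo \<open>p\<close> is lifted to modulus
    \<open>p^k\<close> by raising it to the power \<open>p^i\<close>. As this power is odd, it
    preserves both the sign in \<open>- (Q ^ d)\<close> and the value of
    \<open>\<epsilon>\<close>.\<close>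
  have "[((- (Q ^ d)) ^ j) ^ (p ^ i) = \<epsilon> ^ (p ^ i)] (mod int p ^ Suc i)"
    unfolding \<epsilon>_def
    by (intro cong_power_prime_power Legendre_cong_of_dvd_lucas_V assms(1,2,4,5) j)
  also have "((- (Q ^ d)) ^ j) ^ (p ^ i) = ((- (Q ^ d)) ^ (p ^ i)) ^ j"
    by (simp flip: power_mult add: mult.commute)
  also have "(- (Q ^ d)) ^ (p ^ i) = - (Q ^ m)"
    using odd by (simp add: m_def mult.commute flip: power_mult)
  also have "\<epsilon> ^ (p ^ i) = \<epsilon>" using \<epsilon> odd by auto
  finally have "[y = \<epsilon>] (mod int p ^ k)" by (simp add: y_def i)
  then have "[y + int p ^ k * t = \<epsilon> + 0] (mod int p ^ k)"
    by (intro cong_add) (simp_all add: cong_0_iff)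
  then show ?thesis
    using unit_congI[OF \<epsilon>_unit _ assms(6) eq] by (simp add: \<epsilon>_def)
qed

section \<open>Quotients at the prime 2\<close>

text \<open>By the odd expansion the cofactor of \<open>P\<close> is \<open>d (-Q)^j\<close> plus a
  multiple of \<open>P^2\<close>, hence odd.\<close>

lemma lucas_V_odd_index_even_P:
  assumes "even P" "odd Q" "odd d"
  shows "\<exists>c. odd c \<and> lucas_V P Q d = P * c"
proof -
  obtain j where j: "d = 2 * j + 1" using assms(3) by (rule oddE)
  obtain B where B: "lucas_V P Q d = P * (of_nat (2 * j + 1) * (- Q) ^ j + P\<^sup>2 * B)"
    using lucas_V_odd_expansion(2) unfolding j by blast
  moreover have "odd (of_nat (2 * j + 1) * (- Q) ^ j + P\<^sup>2 * B)"
    using assms by simp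
  ultimately show ?thesis by blast
qed

lemma odd_square_cong_8:
  assumes "odd (a::int)"
  shows "[a\<^sup>2 = 1] (mod 8)"
proof -
  obtain b where b: "a = 2 * b + 1" using assms by (rule oddE)
  have "even (b * (b + 1))" by simp
  then obtain c where "b * (b + 1) = 2 * c" by (rule evenE)
  then have "a\<^sup>2 - 1 = 8 * c" by (simp add: b power2_eq_square algebra_simps)
  then show ?thesis by (simp add: cong_iff_dvd_diff)
qed

lemma odd_power_two_power_cong:
  assumes "odd (a::int)"
  shows "[a ^ (2 ^ Suc i) = 1] (mod 2 ^ (i + 3))"
proof (induction i)
  case 0
  then show ?case using odd_square_cong_8[OF assms] by simp
next
  case (Suc i)
  then have "[(a ^ (2 ^ Suc i)) ^ 2 = 1 ^ 2] (mod int 2 ^ Suc (i + 3))"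
    by (intro cong_power_lift) simp_all
  then show ?case by (simp flip: power_mult add: mult.commute)
qed

lemma lucas_V_double_even:
  assumes "lucas_V P Q m = 2 * x"
  shows "lucas_V P Q (2 * m) = 2 * (2 * x\<^sup>2 - Q ^ m)"
  by (simp add: lucas_V_double assms power2_eq_square)

text \<open>Here \<open>x = 2 (y c)^2 - Q^d\<close> with \<open>y = P / 2\<close> and
  \<open>c\<close> odd. Odd squares are 1 modulo 4, so the class of \<open>x\<close> does not depend
  on \<open>d\<close>; this yields a common sign for all odd \<open>d\<close>.\<close>

lemma lucas_V_2_odd:
  assumes "even P" "odd Q" "odd d"
  shows "\<exists>x. odd x \<and> [x = 2 * (P div 2)\<^sup>2 - Q] (mod 4) \<and> lucas_V P Q (2 * d) = 2 * x"
proof -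
  obtain c where c: "odd c" "lucas_V P Q d = P * c"
    using lucas_V_odd_index_even_P[OF assms] by blast
  define y where "y = P div 2"
  have V: "lucas_V P Q d = 2 * (y * c)" using assms(1) c(2) by (simp add: y_def)
  obtain j where j: "d = 2 * j + 1" using assms(3) by (rule oddE)
  have four: "[a\<^sup>2 = 1] (mod 4)" if "odd a" for a :: int
    using cong_dvd_modulus[OF odd_square_cong_8[OF that], of 4] by simp
  have "[2 * (y\<^sup>2 * c\<^sup>2) - (Q\<^sup>2) ^ j * Q = 2 * (y\<^sup>2 * 1) - 1 ^ j * Q] (mod 4)"
    using assms(2) c(1) by (intro cong_diff cong_mult cong_refl cong_pow four)
  then have "[2 * (y * c)\<^sup>2 - Q ^ d = 2 * y\<^sup>2 - Q] (mod 4)"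
    unfolding j power_add power_mult power_mult_distrib by simp
  moreover have "odd (2 * (y * c)\<^sup>2 - Q ^ d)" using assms(2) by simp
  ultimately show ?thesis
    using lucas_V_double_even[OF V] unfolding y_def by blast
qed

text \<open>Doubling the index replaces half of \<open>V_m\<close> by \<open>2 x^2 - Q^m\<close>.
  Both \<open>x^2\<close> and \<open>Q^m\<close> are 1 modulo the next power of 2, so each doubling
  gains one power, starting from modulus 8 at index \<open>4 d\<close>.\<close>

lemma lucas_V_4_odd:
  assumes "even P" "odd Q" "odd d"
  shows "\<exists>x. [x = 1] (mod 2 ^ (i + 3)) \<and> lucas_V P Q (2 ^ (i + 2) * d) = 2 * x"
proof (induction i)
  case 0
  obtain x where x: "odd x" "lucas_V P Q (2 * d) = 2 * x"
    using lucas_V_2_odd[OF assms] by blast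
  have "[2 * x\<^sup>2 - (Q ^ d)\<^sup>2 = 2 * 1 - 1] (mod 8)"
    using x(1) assms(2) by (intro cong_diff cong_mult cong_refl odd_square_cong_8) simp_all
  then have "[2 * x\<^sup>2 - Q ^ (2 * d) = 1] (mod 2 ^ (0 + 3))"
    by (simp add: mult.commute flip: power_mult)
  then show ?case
    using lucas_V_double_even[OF x(2)] by (auto simp: mult.assoc[symmetric])
next
  case (Suc i)
  then obtain x where x: "[x = 1] (mod 2 ^ (i + 3))" "lucas_V P Q (2 ^ (i + 2) * d) = 2 * x"
    by blast
  have "[x\<^sup>2 = 1\<^sup>2] (mod int 2 ^ Suc (i + 3))"
    using x(1) by (intro cong_power_lift) simp_all
  then have "[x\<^sup>2 = 1] (mod 2 ^ (Suc i + 3))" by simp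
  moreover have "[(Q ^ d) ^ (2 ^ Suc (Suc i)) = 1] (mod 2 ^ (Suc i + 3))"
    using assms(2) by (intro odd_power_two_power_cong) simp
  moreover have "(Q ^ d) ^ (2 ^ Suc (Suc i)) = Q ^ (2 ^ (i + 2) * d)"
    by (simp add: mult.commute flip: power_mult)
  ultimately have "[2 * x\<^sup>2 - Q ^ (2 ^ (i + 2) * d) = 2 * 1 - 1] (mod 2 ^ (Suc i + 3))"
    by (intro cong_diff cong_mult cong_refl) simp_all
  then have "[2 * x\<^sup>2 - Q ^ (2 ^ (i + 2) * d) = 1] (mod 2 ^ (Suc i + 3))" by simp
  moreover have "2 ^ (Suc i + 2) * d = 2 * (2 ^ (i + 2) * d)" by simp
  ultimately show ?case
    using lucas_V_double_even[OF x(2)] by metis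
qed

text \<open>For \<open>P\<close> even and \<open>Q\<close> odd, \<open>V_{2^k d} / V_{2^{k-1} d}\<close> agrees with this constant
  up to a factor congruent to 1 modulo \<open>2 ^ k\<close>, for every odd \<open>d\<close>.\<close>

definition dyadic_const :: "int \<Rightarrow> int \<Rightarrow> nat \<Rightarrow> rat" where
  "dyadic_const P Q k = (if k = 1 then 2 / of_int P
     else if k = 2 \<and> \<not> [2 * (P div 2)\<^sup>2 - Q = 1] (mod 4) then - 1 else 1)"

text \<open>For \<open>k = 1\<close> the modulus is 2 and any quotient of odd cofactors will do. For
  \<open>k = 2\<close> the denominator still retains its sign modulo 4. For \<open>k >= 3\<close>
  half the numerator and half the denominator are both 1 modulo \<open>2^k\<close>.\<close>

lemma lucas_V_quot_even_P:
  assumes "even P" "odd Q" "odd d" "P \<noteq> 0" "k \<ge> 1"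
  shows "unit_cong 2 k (lucas_V_quot P Q 2 k d / dyadic_const P Q k)"
proof -
  consider "k = 1" | "k = 2" | i where "k = i + 3"
    using assms(5) by (metis One_nat_def Suc_1 add.commute add_2_eq_Suc' le_Suc_ex numeral_3_eq_3
        plus_1_eq_Suc not0_implies_Suc add_0 add_Suc_right)
  then show ?thesis
  proof cases
    case 1
    obtain x where x: "odd x" "lucas_V P Q (2 * d) = 2 * x"
      using lucas_V_2_odd[OF assms(1-3)] by blast
    obtain c where c: "odd c" "lucas_V P Q d = P * c"
      using lucas_V_odd_index_even_P[OF assms(1-3)] by blast
    have "c \<noteq> 0" using c(1) by auto
    show ?thesis
    proof (rule unit_congI)
      show "[x = c] (mod int 2 ^ k)" using x(1) c(1) 1 by (simp add: cong_iff_dvd_diff)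
      show "lucas_V_quot P Q 2 k d / dyadic_const P Q k = of_int x / of_int c"
        using x(2) c(2) 1 assms(4) \<open>c \<noteq> 0\<close> by (simp add: lucas_V_quot_def dyadic_const_def)
    qed (use c(1) assms(5) in auto)
  next
    case 2
    obtain x where x: "odd x" "[x = 2 * (P div 2)\<^sup>2 - Q] (mod 4)" "lucas_V P Q (2 * d) = 2 * x"
      using lucas_V_2_odd[OF assms(1-3)] by blast
    obtain y where y: "[y = 1] (mod 8)" "lucas_V P Q (2 ^ 2 * d) = 2 * y"
      using lucas_V_4_odd[OF assms(1-3), of 0] by auto
    have "x \<noteq> 0" using x(1) by auto
    have y4: "[y = 1] (mod 4)"
      using cong_dvd_modulus[OF y(1), of 4] by simp
    \<comment> \<open>\<open>e\<close> is the class of the odd number \<open>x\<close> modulo 4,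
      read as a sign; it makes \<open>e * x\<close> congruent to 1.\<close>
    define e where "e = (if [x = 1] (mod 4) then 1 else - 1 :: int)"
    have "x mod 4 = 1 \<or> x mod 4 = 3" using x(1) by presburger
    then have "[e * x = 1] (mod 4)"
      by (auto simp: e_def cong_def) presburger
    have "[x = 1] (mod 4) \<longleftrightarrow> [2 * (P div 2)\<^sup>2 - Q = 1] (mod 4)"
      using x(2) cong_sym cong_trans by blast
    then have dc: "dyadic_const P Q k = of_int e"
      using 2 by (simp add: dyadic_const_def e_def)
    show ?thesis
    proof (rule unit_congI)
      show "[y = e * x] (mod int 2 ^ k)"
        using y4 \<open>[e * x = 1] (mod 4)\<close> 2 by (simp add: cong_def)
      show "lucas_V_quot P Q 2 k d / dyadic_const P Q k = of_int y / of_int (e * x)"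
        using x(3) y(2) 2 \<open>x \<noteq> 0\<close> unfolding dc by (simp add: lucas_V_quot_def)
      show "\<not> int 2 dvd e * x" using x(1) by (simp add: e_def)
    qed (use assms(5) in auto)
  next
    case (3 i)
    obtain x where x: "[x = 1] (mod 2 ^ (i + 3))" "lucas_V P Q (2 ^ (i + 2) * d) = 2 * x"
      using lucas_V_4_odd[OF assms(1-3)] by blast
    obtain y where y: "[y = 1] (mod 2 ^ (Suc i + 3))" "lucas_V P Q (2 ^ (Suc i + 2) * d) = 2 * y"
      using lucas_V_4_odd[OF assms(1-3)] by blast
    have y': "[y = 1] (mod 2 ^ (i + 3))"
      by (rule cong_dvd_modulus[OF y(1)]) (simp add: le_imp_power_dvd)
    have "[x = 1] (mod 2)"
      by (rule cong_dvd_modulus[OF x(1)]) simp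
    then have "odd x" by (simp add: cong_def odd_iff_mod_2_eq_one)
    then have "x \<noteq> 0" by auto
    have k: "k - 1 = i + 2" "k = Suc i + 2" using 3 by simp_all
    show ?thesis
    proof (rule unit_congI)
      show "[y = x] (mod int 2 ^ k)"
        using cong_trans[OF y' cong_sym[OF x(1)]] 3 by simp
      show "lucas_V_quot P Q 2 k d / dyadic_const P Q k = of_int y / of_int x"
        unfolding lucas_V_quot_def k(1) x(2) using y(2) unfolding k(2)[symmetric]
        using 3 by (simp add: dyadic_const_def)
    qed (use \<open>odd x\<close> assms(5) in auto)
  qed
qed

text \<open>Modulo 2 the recurrence is that of the Fibonacci numbers, which has period 3.\<close>

lemma even_lucas_V_iff:
  assumes "odd P" "odd Q"
  shows "even (lucas_V P Q n) \<longleftrightarrow> 3 dvd n"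
proof (induction n rule: less_induct)
  case (less n)
  consider "n = 0" | "n = 1" | "n = 2" | m where "n = Suc (Suc (Suc m))"
    by (metis One_nat_def Suc_1 not0_implies_Suc)
  then show ?case
  proof cases
    case 4
    have "even (lucas_V P Q n) \<longleftrightarrow> even (lucas_V P Q m)"
      unfolding 4 lucas_V_Suc_Suc using assms by auto
    also have "\<dots> \<longleftrightarrow> 3 dvd m" using less 4 by simp
    also have "\<dots> \<longleftrightarrow> 3 dvd n" unfolding 4 by presburger
    finally show ?thesis .
  qed (use assms lucas_V_double[of P Q 1] in \<open>simp_all add: lucas_V_rec\<close>)
qed

section \<open>Moebius products of Lucas numbers\<close>

text \<open>If \<open>p\<close> divided \<open>Q\<close>, then \<open>U_{n+1}\<close> would be
  congruent to \<open>P^n\<close> and so prime to \<open>p\<close>, leaving no rank.\<close>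

lemma rank_U_nonzero_imp_not_dvd_Q:
  assumes "lucas_D P Q \<noteq> 0" "prime p" "\<not> int p dvd gcd P Q" "rank_U P Q p \<noteq> 0"
  shows "\<not> int p dvd Q"
proof
  assume Q: "int p dvd Q"
  then have P: "\<not> int p dvd P" using assms(3) by simp
  have "\<not> int p dvd lucas_U P Q (Suc n)" for n
  proof (induction n rule: induct_nat_012)
    case (ge2 n)
    have "int p dvd Q * lucas_U P Q (Suc n)" using Q by simp
    moreover have "\<not> int p dvd P * lucas_U P Q (Suc (Suc n))"
      using ge2 P assms(2) by (simp add: prime_dvd_mult_iff)
    ultimately show ?case
      unfolding lucas_U_Suc_Suc[OF assms(1), of "Suc n"] by (metis dvd_diff_left_iff)
  qed (use P assms(2) in \<open>auto simp: lucas_U_rec[OF assms(1)] not_prime_unit\<close>)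
  then have "\<not> int p dvd lucas_U P Q n" if "n \<ge> 1" for n
    using that by (cases n) auto
  then have "rank_U P Q p = 0" unfolding rank_U_def by (metis (no_types, lifting))
  then show False using assms(4) by blast
qed

lemma lucas_MV_unit_cong:
  assumes "prime p" "coprime p n" "n > 0" "k \<ge> 1"
    and "\<And>d. d dvd n \<Longrightarrow> \<not> int p dvd lucas_V P Q d"
  shows "unit_cong p k (lucas_MV P Q (p ^ k * n))"
  unfolding lucas_MV_eq_prod_quot[OF assms(1,2,4,3)] using assms
  by (intro unit_cong_prod unit_cong_power_int lucas_V_quot_unit_cong) auto

text \<open>An odd rank dividing \<open>2 d\<close> already divides \<open>d\<close>, so
  \<open>p\<close> divides no \<open>V_d\<close> and every quotient is a principal unit.\<close>

lemma lucas_MV_unit_cong_odd_rank: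
  assumes "lucas_setting P Q p n" "p > 2" "k \<ge> 1" "rank_U P Q p = 0 \<or> odd (rank_U P Q p)"
  shows "unit_cong p k (lucas_MV P Q (p ^ k * n))"
proof (rule lucas_MV_unit_cong)
  show "\<not> int p dvd lucas_V P Q d" if "d dvd n" for d
  proof -
    have "d > 0" using that assms(1) by (auto simp: lucas_setting_def dest: dvd_pos_nat)
    moreover have "rank_U P Q p dvd d" if "rank_U P Q p dvd 2 * d" "odd (rank_U P Q p)"
      using that by (simp add: coprime_dvd_mult_right_iff)
    ultimately show ?thesis
      using odd_prime_dvd_lucas_V_iff[of P Q p d] assms by (auto simp: lucas_setting_def)
  qed
qed (use assms in \<open>auto simp: lucas_setting_def\<close>)

text \<open>For rank \<open>2 h\<close>, the indices \<open>d\<close> with \<open>p\<close> dividing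
  \<open>V_d\<close> form \<open>T\<close>. Since \<open>h\<close> itself lies in \<open>T\<close>,
  \<open>p\<close> does not divide \<open>D\<close>, so the Legendre symbol is a sign and the
  constant is nonzero.\<close>

lemma lucas_MV_even_rank:
  assumes "lucas_setting P Q p n" "p > 2" "k \<ge> 1" "rank_U P Q p = 2 * h" "h > 0"
  shows "\<not> int p dvd lucas_D P Q"
    and "\<exists>w. unit_cong p k w \<and> lucas_MV P Q (p ^ k * n)
      = of_int (Legendre (lucas_D P Q) (int p) * int p)
          powi ((if n = h then 1 else 0) - (if n = 2 * h then 1 else 0)) * w"
proof -
  let ?c = "of_int (Legendre (lucas_D P Q) (int p) * int p) :: rat"
  define T where "T = {d. h dvd d \<and> \<not> 2 * h dvd d}"
  have D: "lucas_D P Q \<noteq> 0" and p: "prime p" and n: "n > 0" and co: "coprime p n"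
    and nd: "lucas_nondegenerate P Q" and gcd: "\<not> int p dvd gcd P Q"
    using assms(1) by (auto simp: lucas_setting_def)
  have Q: "\<not> int p dvd Q"
    using rank_U_nonzero_imp_not_dvd_Q[OF D p gcd] assms(4,5) by simp
  have V_iff: "int p dvd lucas_V P Q d \<longleftrightarrow> d \<in> T" if "d > 0" for d
    using odd_prime_dvd_lucas_V_iff[OF D p assms(2) gcd that] Q assms(4,5) by (simp add: T_def)
  have "h \<in> T" using assms(5) by (auto simp: T_def dest: dvd_imp_le)
  then show pD: "\<not> int p dvd lucas_D P Q"
    using V_iff[OF assms(5)] odd_prime_dvd_lucas_V(2)[OF D p assms(2) Q] by blast
  then have "?c \<noteq> 0"
    using assms(2) by (auto simp: Legendre_def cong_0_iff)
  moreover have "unit_cong p k (lucas_V_quot P Q p k d / (if d \<in> T then ?c else 1))" if "d dvd n" for d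
  proof -
    have d: "d > 0" using that n by (auto dest: dvd_pos_nat)
    then have "p ^ (k - 1) * d \<ge> 1"
      using prime_gt_0_nat[OF p] by (simp add: Suc_leI)
    then have "lucas_V P Q (p ^ (k - 1) * d) \<noteq> 0"
      using nd unfolding lucas_nondegenerate_def by blast
    then show ?thesis
      using V_iff[OF d] lucas_V_quot_unit_cong[OF p _ assms(3)]
        lucas_V_quot_odd_prime[OF D p assms(2) Q _ assms(3)] by simp
  qed
  ultimately have "\<exists>w. unit_cong p k w \<and> lucas_MV P Q (p ^ k * n)
      = ?c powi (\<Sum>d | d dvd n \<and> d \<in> T. moebius (n div d)) * w"
    unfolding lucas_MV_eq_prod_quot[OF p co assms(3) n]
    by (intro prod_powi_moebius_unit_cong p n)
  \<comment> \<open>The sum over \<open>T\<close> is the sum over multiples of \<open>h\<close>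
    minus that over multiples of \<open>2 h\<close>, and each is a Moebius indicator.\<close>
  moreover have "(\<Sum>d | d dvd n \<and> d \<in> T. moebius (n div d))
      = (if n = h then 1 else 0) - (if n = 2 * h then 1 else 0)"
  proof -
    have "{d. d dvd n \<and> d \<in> T} = {d. d dvd n \<and> h dvd d} - {d. d dvd n \<and> 2 * h dvd d}"
      by (auto simp: T_def)
    moreover have "{d. d dvd n \<and> 2 * h dvd d} \<subseteq> {d. d dvd n \<and> h dvd d}"
      by (auto elim: dvd_mult_right)
    ultimately have "(\<Sum>d | d dvd n \<and> d \<in> T. moebius (n div d))
      = (\<Sum>d | d dvd n \<and> h dvd d. moebius (n div d)) - (\<Sum>d | d dvd n \<and> 2 * h dvd d. moebius (n div d))"
      using n by (simp add: sum_diff)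
    then show ?thesis
      using sum_moebius_codivisors_multiples[OF n, of h] sum_moebius_codivisors_multiples[OF n, of "2 * h"]
        assms(5) by simp
  qed
  ultimately show "\<exists>w. unit_cong p k w \<and> lucas_MV P Q (p ^ k * n)
      = ?c powi ((if n = h then 1 else 0) - (if n = 2 * h then 1 else 0)) * w"
    by simp
qed

lemma dyadic_const_nonzero: "P \<noteq> 0 \<Longrightarrow> dyadic_const P Q k \<noteq> 0"
  by (simp add: dyadic_const_def)

text \<open>An even \<open>D\<close> forces \<open>P\<close> even, hence \<open>Q\<close> odd by the
  gcd condition. Every divisor of \<open>n\<close> then carries the same constant, so
  \<open>T\<close> is everything and the constant survives only for \<open>n = 1\<close>.\<close>

lemma lucas_MV_even_D:
  assumes "lucas_setting P Q 2 n" "k \<ge> 1" "even (lucas_D P Q)"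
  shows "\<exists>w. unit_cong 2 k w \<and>
    lucas_MV P Q (2 ^ k * n) = dyadic_const P Q k powi (if n = 1 then 1 else 0) * w"
proof -
  have P: "even P" "P \<noteq> 0" and Q: "odd Q" and n: "n > 0" "odd n" "coprime 2 n"
    using assms(1,3) by (auto simp: lucas_setting_def lucas_D_def)
  have "unit_cong 2 k (lucas_V_quot P Q 2 k d / (if d \<in> UNIV then dyadic_const P Q k else 1))"
    if "d dvd n" for d
  proof -
    have "odd d" using that n(2) dvd_trans by blast
    then show ?thesis using lucas_V_quot_even_P P Q assms(2) by simp
  qed
  then have "\<exists>w. unit_cong 2 k w \<and> lucas_MV P Q (2 ^ k * n)
      = dyadic_const P Q k powi (\<Sum>d | d dvd n \<and> d \<in> UNIV. moebius (n div d)) * w"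
    unfolding lucas_MV_eq_prod_quot[OF two_is_prime_nat n(3) assms(2) n(1)]
    by (intro prod_powi_moebius_unit_cong two_is_prime_nat n dyadic_const_nonzero P)
  then show ?thesis
    using sum_moebius_codivisors[OF n(1)] by simp
qed

text \<open>If \<open>P\<close> and \<open>Q\<close> are odd, the indices divisible by 3 reduce to the parameters
  \<open>V_3\<close> and \<open>Q^3\<close>, with \<open>V_3\<close> even.\<close>

lemma lucas_MV_odd_D:
  assumes "lucas_setting P Q 2 n" "k \<ge> 1" "odd (lucas_D P Q)" "n \<noteq> 3 \<or> k \<noteq> 1"
  shows "unit_cong 2 k (lucas_MV P Q (2 ^ k * n))"
proof -
  have P: "odd P" and n: "n > 0" "odd n" "coprime 2 n" and nd: "lucas_nondegenerate P Q"
    using assms(1,3) by (auto simp: lucas_setting_def lucas_D_def)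
  show ?thesis
  proof (cases "even Q")
    case True
    have "odd (lucas_V P Q d)" if "d dvd n" for d
    proof -
      obtain m where "d = Suc m" using \<open>d dvd n\<close> n(1) by (cases d) auto
      then show ?thesis
        using cong_dvd_iff[OF lucas_V_cong_power[OF two_is_prime_nat, of Q P m]] True P by simp
    qed
    then show ?thesis
      using lucas_MV_unit_cong[OF two_is_prime_nat n(3,1) assms(2)] by simp
  next
    case False
    define P' Q' where "P' = lucas_V P Q 3" and "Q' = Q ^ 3"
    have even_V: "even (lucas_V P Q d) \<longleftrightarrow> 3 dvd d" for d
      using even_lucas_V_iff[OF P False] .
    have P': "even P'" "P' \<noteq> 0" and Q': "odd Q'"
      using even_V[of 3] nd False by (auto simp: P'_def Q'_def lucas_nondegenerate_def)
    let ?c = "dyadic_const P' Q' k"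
    have "unit_cong 2 k (lucas_V_quot P Q 2 k d / (if d \<in> {d. 3 dvd d} then ?c else 1))"
      if d: "d dvd n" for d
    proof (cases "3 dvd d")
      case True
      then obtain e where e: "d = 3 * e" by (rule dvdE)
      have "odd e" using n(2) d unfolding e by (meson dvd_trans dvd_triv_right even_mult_iff)
      moreover have "lucas_V_quot P Q 2 k d = lucas_V_quot P' Q' 2 k e"
      proof -
        have "lucas_V P Q (2 ^ j * d) = lucas_V P' Q' (2 ^ j * e)" for j
          using lucas_V_mult[of P Q 3 "2 ^ j * e"] unfolding e P'_def Q'_def mult.left_commute[of _ 3] .
        then show ?thesis unfolding lucas_V_quot_def by (simp only:)
      qed
      ultimately show ?thesis
        using lucas_V_quot_even_P[of P' Q' e k] P' Q' assms(2) True by simp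
    next
      case False
      then show ?thesis
        using lucas_V_quot_unit_cong[OF two_is_prime_nat _ assms(2)] even_V by simp
    qed
    then have "\<exists>w. unit_cong 2 k w \<and> lucas_MV P Q (2 ^ k * n)
        = ?c powi (\<Sum>d | d dvd n \<and> d \<in> {d. 3 dvd d}. moebius (n div d)) * w"
      unfolding lucas_MV_eq_prod_quot[OF two_is_prime_nat n(3) assms(2) n(1)]
      by (intro prod_powi_moebius_unit_cong two_is_prime_nat n dyadic_const_nonzero P')
    then obtain w where w: "unit_cong 2 k w"
      "lucas_MV P Q (2 ^ k * n) = ?c powi (if n = 3 then 1 else 0) * w"
      using sum_moebius_codivisors_multiples[OF n(1), of 3] by auto
    \<comment> \<open>Only \<open>k = 2\<close> needs work: the sign is shown to be positive using
      \<open>V_3 = P (P^2 - 3 Q)\<close>. If \<open>Q\<close> is 1 modulo 4, \<open>V_3 / 2\<close>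
      is odd and the test value is \<open>2 - 1\<close>; if \<open>Q\<close> is 3 modulo 4, it is
      even and the test value is \<open>0 - 3\<close>. Both are 1 modulo 4.\<close>
    have "?c = 1" if "k \<noteq> 1"
    proof -
      have V3: "P' = P * (P\<^sup>2 - 3 * Q)"
        by (simp add: P'_def numeral_3_eq_3 lucas_V_rec power2_eq_square algebra_simps)
      obtain y where y: "P' = 2 * y" using P'(1) by (rule evenE)
      have P2: "[P\<^sup>2 = 1] (mod 8)" and Q2: "[Q\<^sup>2 = 1] (mod 8)"
        using P False by (auto intro: odd_square_cong_8)
      have "[Q * Q\<^sup>2 = Q * 1] (mod 4)"
        using cong_dvd_modulus[OF Q2, of 4] by (intro cong_mult cong_refl) simp
      then have Q'_cong: "[Q' = Q] (mod 4)"
        by (simp add: Q'_def power2_eq_square power3_eq_cube mult.assoc)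
      have P2': "P\<^sup>2 mod 4 = 1"
        using cong_dvd_modulus[OF P2, of 4] by (simp add: cong_def)
      have "[2 * y\<^sup>2 - Q' = 1] (mod 4)"
      proof (cases "Q mod 4 = 1")
        case True
        have "odd y"
        proof
          assume "even y"
          then have "4 dvd P * (P\<^sup>2 - 3 * Q)" unfolding V3[symmetric] y by presburger
          moreover have "coprime 2 P" using P by simp
          then have "coprime (2\<^sup>2) P" using coprime_power_left_iff by blast
          then have "coprime 4 P" by simp
          ultimately have "4 dvd P\<^sup>2 - 3 * Q" by (simp add: coprime_dvd_mult_right_iff)
          then show False using True P2' by presburger
        qed
        then have "[2 * y\<^sup>2 = 2 * 1] (mod 4)"
          using cong_dvd_modulus[OF odd_square_cong_8, of y 4] by (intro cong_mult cong_refl) simp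
        then have "[2 * y\<^sup>2 - Q' = 2 * 1 - 1] (mod 4)"
          using Q'_cong True by (intro cong_diff) (simp_all add: cong_def)
        then show ?thesis by simp
      next
        case Q3: False
        then have Q3: "Q mod 4 = 3" using False by presburger
        then have "4 dvd P\<^sup>2 - 3 * Q" using P2' by presburger
        then have "4 dvd 2 * y" unfolding y[symmetric] V3 by simp
        then have "even y" by presburger
        then obtain u where "y = 2 * u" by (rule evenE)
        then have "[2 * y\<^sup>2 = 0] (mod 4)" by (simp add: cong_0_iff power2_eq_square)
        then have "[2 * y\<^sup>2 - Q' = 0 - 3] (mod 4)"
          using Q'_cong Q3 by (intro cong_diff) (simp_all add: cong_def)
        then show ?thesis by (simp add: cong_def)
      qed
      then show ?thesis using that y by (simp add: dyadic_const_def)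
    qed
    then show ?thesis using w assms(4) by auto
  qed
qed

section \<open>Small values and nondegenerate examples\<close>

lemma moebius_1: "moebius (Suc 0) = 1"
  by (simp add: moebius_def)

lemma moebius_prime:
  assumes "prime p"
  shows "moebius p = - 1"
  using moebius_prime_mult[OF assms, of 1] prime_gt_1_nat[OF assms] by (auto simp: moebius_1)

lemma lucas_MV_2: "lucas_MV P Q 2 = of_int (lucas_V P Q 2) / of_int P"
  using lucas_MV_eq_prod_quot[OF two_is_prime_nat, of 1 1 P Q]
  by (simp add: lucas_V_quot_def moebius_def lucas_V_1)

lemma lucas_MV_6: "lucas_MV P Q 6 = of_int (lucas_V P Q 6) / of_int (lucas_V P Q 3)
  / (of_int (lucas_V P Q 2) / of_int P)"
proof -
  have p3: "prime (3::nat)" by simp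
  have "{d. d dvd 3} = {1, 3::nat}"
    using p3 by (auto simp: prime_nat_iff)
  moreover have "coprime 2 (3::nat)" by simp
  ultimately show ?thesis
    using lucas_MV_eq_prod_quot[OF two_is_prime_nat, of 3 1 P Q] moebius_prime[OF p3]
    by (simp add: lucas_V_quot_def moebius_1 lucas_V_1 power_int_minus field_simps flip: numeral_2_eq_2)
qed

text \<open>With \<open>P > 0\<close> and \<open>Q < 0\<close> both coefficients of the recurrence
  are positive, so no term vanishes; this certifies the numerical examples.\<close>

lemma lucas_setting_positive:
  assumes "P > 0" "Q < 0" "prime p" "n > 0" "coprime p n" "\<not> int p dvd gcd P Q"
  shows "lucas_setting P Q p n"
proof -
  have "lucas_D P Q > 0" using assms(1,2) unfolding lucas_D_def
    by (metis add_pos_pos diff_gt_0_iff_gt less_trans mult_pos_neg zero_less_numeral zero_less_power)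
  then have D: "lucas_D P Q \<noteq> 0" by simp
  have pos: "P * a - Q * b > 0" if "a > 0" "b \<ge> 0" for a b
    using that assms(1,2) by (smt (verit) mult_nonpos_nonneg mult_pos_pos)
  have "lucas_V P Q n > 0" for n
    by (induction n rule: induct_nat_012) (use assms(1) pos in \<open>auto simp: lucas_V_rec\<close>)
  moreover have U: "lucas_U P Q (Suc n) > 0" for n
    by (induction n rule: induct_nat_012) (use assms(1) pos in \<open>auto simp: lucas_U_rec[OF D]\<close>)
  moreover have "lucas_U P Q n \<noteq> 0" if "n \<ge> 1" for n
    using U[of "n - 1"] that by auto
  ultimately have "lucas_nondegenerate P Q"
    unfolding lucas_nondegenerate_def by (metis less_irrefl)
  then show ?thesis using D assms by (auto simp: lucas_setting_def)
qed

lemma fraction_not_in_loc_ring: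
  assumes "prime p" "\<not> int p dvd a" "\<not> int p dvd b"
  shows "of_int a / of_int (int p * b) \<notin> loc_ring p"
proof
  assume "of_int a / of_int (int p * b) \<in> loc_ring p"
  then obtain c d where cd: "\<not> int p dvd d" "of_int a / of_int (int p * b) = (of_int c / of_int d :: rat)"
    using loc_ring_iff[OF assms(1)] by blast
  have "d \<noteq> 0" "int p * b \<noteq> 0" using cd(1) assms by auto
  then have "(of_int (a * d) :: rat) = of_int (c * (int p * b))"
    using cd(2) by (simp add: frac_eq_eq del: of_int_of_nat_eq)
  then have "a * d = c * (int p * b)" by (simp only: of_int_eq_iff)
  then have "int p dvd a * d" by simp
  then show False using assms cd(1) by (simp add: prime_dvd_mult_iff)
qed

section \<open>The cases of the theorem\<close>

text \<open>The exclusions cover every place where a constant other than 1 enters the product with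
  nonzero exponent.\<close>

lemma lucas_MV_not_exceptional:
  assumes "lucas_setting P Q p n" "k \<ge> 1"
    "\<not> exceptional P Q p n k" "\<not> sign_case P Q p n k" "\<not> half_rank_case P Q p n"
  shows "unit_cong p k (lucas_MV P Q (p ^ k * n))"
proof -
  have p: "prime p" and n: "n > 0" using assms(1) by (auto simp: lucas_setting_def)
  show ?thesis
  proof (cases "p = 2")
    case True
    show ?thesis
    proof (cases "even (lucas_D P Q)")
      case even: True
      obtain w where w: "unit_cong 2 k w"
        "lucas_MV P Q (2 ^ k * n) = dyadic_const P Q k powi (if n = 1 then 1 else 0) * w"
        using lucas_MV_even_D[of P Q n k] assms(1,2) True even by blast
      \<comment> \<open>For \<open>n = 1\<close> the exclusions leave only
        \<open>k >= 3\<close>.\<close>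
      have "dyadic_const P Q k = 1" if "n = 1"
        using that assms(2-4) True even by (auto simp: exceptional_def case_i_def sign_case_def dyadic_const_def)
      then show ?thesis using w True by auto
    next
      case False
      then show ?thesis
        using lucas_MV_odd_D[of P Q n k] assms True by (auto simp: exceptional_def case_ii_def)
    qed
  next
    case False
    then have p2: "p > 2" using prime_ge_2_nat[OF p] by simp
    show ?thesis
    proof (cases "rank_U P Q p = 0 \<or> odd (rank_U P Q p)")
      case True
      then show ?thesis using lucas_MV_unit_cong_odd_rank assms(1,2) p2 by blast
    next
      case False
      then obtain h where h: "rank_U P Q p = 2 * h" "h > 0" by (auto elim: evenE)
      have "n \<noteq> h" "n \<noteq> 2 * h"
        using assms(3,5) h p2 lucas_MV_even_rank(1)[OF assms(1) p2 assms(2) h]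
        by (auto simp: exceptional_def case_iii_def half_rank_case_def)
      then show ?thesis
        using lucas_MV_even_rank(2)[OF assms(1) p2 assms(2) h] by auto
    qed
  qed
qed

text \<open>The constant enters with exponent 1, and its factor \<open>p\<close> adds one power to
  the precision of the principal unit.\<close>

lemma lucas_MV_half_rank:
  assumes "lucas_setting P Q p n" "k \<ge> 1" "half_rank_case P Q p n"
  shows "loc_cong p (k + 1) (lucas_MV P Q (p ^ k * n))
    (of_int (Legendre (lucas_D P Q) (int p)) * of_nat p)"
proof -
  have p: "prime p" and n: "n > 0" using assms(1) by (auto simp: lucas_setting_def)
  have "p > 2" "rank_U P Q p = 2 * n" using assms(3) by (auto simp: half_rank_case_def)
  from lucas_MV_even_rank(2)[OF assms(1) this(1) assms(2) this(2) n] n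
  obtain w where "unit_cong p k w"
    "lucas_MV P Q (p ^ k * n) = of_int (Legendre (lucas_D P Q) (int p) * int p) * w" by auto
  then show ?thesis
    using loc_cong_unit_cong[OF p, of k w 1 "Legendre (lucas_D P Q) (int p)"] by simp
qed

text \<open>The constant enters with exponent -1, leaving exactly one factor \<open>p\<close> in the
  denominator.\<close>

lemma lucas_MV_case_iii:
  assumes "lucas_setting P Q p n" "k \<ge> 1" "case_iii P Q p n"
  shows "lucas_MV P Q (p ^ k * n) \<notin> loc_ring p"
proof -
  have p: "prime p" and n: "n > 0" using assms(1) by (auto simp: lucas_setting_def)
  have p2: "p > 2" and "even n" and rank: "rank_U P Q p = n" and D: "\<not> int p dvd lucas_D P Q"
    using assms(3) by (auto simp: case_iii_def)
  then obtain h where h: "n = 2 * h" by (auto elim: evenE)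
  then have "h > 0" "rank_U P Q p = 2 * h" "n \<noteq> h" using n rank by auto
  from lucas_MV_even_rank(2)[OF assms(1) p2 assms(2) this(2,1)] this(3) h
  obtain w where w: "unit_cong p k w"
    "lucas_MV P Q (p ^ k * n) = of_int (Legendre (lucas_D P Q) (int p) * int p) powi (- 1) * w"
    by auto
  obtain a b where ab: "\<not> int p dvd a" "\<not> int p dvd b" "w = of_int a / of_int b"
    using w(1) unfolding unit_cong_def by blast
  have "\<not> int p dvd Legendre (lucas_D P Q) (int p)"
    using D p by (auto simp: Legendre_def cong_0_iff not_prime_unit)
  then have "\<not> int p dvd Legendre (lucas_D P Q) (int p) * b"
    using ab(2) p by (simp add: prime_dvd_mult_iff)
  moreover have "lucas_MV P Q (p ^ k * n)
      = of_int a / of_int (int p * (Legendre (lucas_D P Q) (int p) * b))"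
    unfolding w(2) ab(3) by (simp add: power_int_minus field_simps)
  ultimately show ?thesis
    using fraction_not_in_loc_ring[OF p ab(1)] by metis
qed

lemma lucas_MV_sign_case:
  assumes "lucas_setting P Q p n" "sign_case P Q p n k"
  shows "loc_cong 2 2 (lucas_MV P Q 4) 1 \<or> loc_cong 2 2 (lucas_MV P Q 4) (- 1)"
proof -
  have "p = 2" "n = 1" "even (lucas_D P Q)" using assms(2) by (auto simp: sign_case_def)
  then obtain w where w: "unit_cong 2 2 w" "lucas_MV P Q 4 = dyadic_const P Q 2 * w"
    using lucas_MV_even_D[of P Q 1 2] assms(1) by auto
  have "dyadic_const P Q 2 = 1 \<or> dyadic_const P Q 2 = - 1" by (simp add: dyadic_const_def)
  moreover have "loc_cong 2 2 (of_int e * w) (of_int e)" for e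
    using loc_cong_unit_cong[OF two_is_prime_nat w(1), of 0 e]
    by (simp only: add_0 power_0 mult_1_right)
  from this[of 1] this[of "- 1"] have "loc_cong 2 2 w 1" "loc_cong 2 2 (- w) (- 1)" by simp_all
  ultimately show ?thesis using w(2) by auto
qed

lemma loc_cong_unit_cong_1:
  assumes "prime p" "unit_cong p k r"
  shows "loc_cong p k r 1"
  using loc_cong_unit_cong[OF assms, of 0 1] by simp

lemma lucas_MV_in_loc_ring:
  assumes "lucas_setting P Q p n" "k \<ge> 1" "\<not> exceptional P Q p n k"
  shows "lucas_MV P Q (p ^ k * n) \<in> loc_ring p"
proof -
  have p: "prime p" using assms(1) by (auto simp: lucas_setting_def)
  consider "sign_case P Q p n k" | "half_rank_case P Q p n"
    | "\<not> sign_case P Q p n k" "\<not> half_rank_case P Q p n" by blast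
  then show ?thesis
  proof cases
    case 1
    then have "p = 2" "n = 1" "k = 2" by (auto simp: sign_case_def)
    then show ?thesis
      using lucas_MV_sign_case[OF assms(1) 1] by (auto simp: loc_cong_def)
  next
    case 2
    then show ?thesis using lucas_MV_half_rank[OF assms(1,2)] by (simp add: loc_cong_def)
  next
    case 3
    then show ?thesis
      using lucas_MV_not_exceptional[OF assms] unit_cong_in_loc_ring[OF p] by blast
  qed
qed

theorem theorem2p2:
  shows
    "(\<forall>P Q p n. lucas_setting P Q p n \<longrightarrow>
        (\<forall>k\<ge>1. \<not> exceptional P Q p n k \<longrightarrow> lucas_MV P Q (p ^ k * n) \<in> loc_ring p) \<and>
        (\<forall>k\<ge>1. case_iii P Q p n \<longrightarrow> lucas_MV P Q (p ^ k * n) \<notin> loc_ring p) \<and>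
        (\<forall>k\<ge>1. \<not> exceptional P Q p n k \<and> \<not> sign_case P Q p n k \<and> \<not> half_rank_case P Q p n \<longrightarrow>
           loc_cong p k (lucas_MV P Q (p ^ k * n)) 1) \<and>
        (\<forall>k. sign_case P Q p n k \<longrightarrow>
           loc_cong 2 2 (lucas_MV P Q 4) 1 \<or> loc_cong 2 2 (lucas_MV P Q 4) (- 1)) \<and>
        (half_rank_case P Q p n \<longrightarrow>
           (\<forall>k\<ge>1. loc_cong p k (lucas_MV P Q (p ^ k * n))
              (of_int (Legendre (lucas_D P Q) (int p)) * of_nat p)) \<and>
           (odd n \<longrightarrow>
              (\<forall>k\<ge>1. loc_cong p (k + 1) (lucas_MV P Q (p ^ k * n))
                 (of_int (Legendre (lucas_D P Q) (int p)) * of_nat p))))) \<and>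
     (\<exists>P Q p n k. lucas_setting P Q p n \<and> case_i P Q p n k \<and>
        lucas_MV P Q (p ^ k * n) \<in> loc_ring p) \<and>
     (\<exists>P Q p n k. lucas_setting P Q p n \<and> case_i P Q p n k \<and>
        lucas_MV P Q (p ^ k * n) \<notin> loc_ring p) \<and>
     (\<exists>P Q p n k. lucas_setting P Q p n \<and> case_ii P Q p n k \<and>
        lucas_MV P Q (p ^ k * n) \<in> loc_ring p) \<and>
     (\<exists>P Q p n k. lucas_setting P Q p n \<and> case_ii P Q p n k \<and>
        lucas_MV P Q (p ^ k * n) \<notin> loc_ring p)"
proof (intro conjI allI impI)
  fix P Q p n assume setting: "lucas_setting P Q p n"
  then have p: "prime p" by (simp add: lucas_setting_def)
  show "lucas_MV P Q (p ^ k * n) \<in> loc_ring p" if "1 \<le> k" "\<not> exceptional P Q p n k" for k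
    using lucas_MV_in_loc_ring setting that by blast
  show "lucas_MV P Q (p ^ k * n) \<notin> loc_ring p" if "1 \<le> k" "case_iii P Q p n" for k
    using lucas_MV_case_iii setting that by blast
  show "loc_cong p k (lucas_MV P Q (p ^ k * n)) 1"
    if "1 \<le> k" "\<not> exceptional P Q p n k \<and> \<not> sign_case P Q p n k \<and> \<not> half_rank_case P Q p n" for k
    using loc_cong_unit_cong_1[OF p] lucas_MV_not_exceptional[OF setting] that by blast
  show "loc_cong 2 2 (lucas_MV P Q 4) 1 \<or> loc_cong 2 2 (lucas_MV P Q 4) (- 1)"
    if "sign_case P Q p n k" for k
    using lucas_MV_sign_case setting that by blast
  assume half: "half_rank_case P Q p n"
  show *: "loc_cong p (k + 1) (lucas_MV P Q (p ^ k * n))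
      (of_int (Legendre (lucas_D P Q) (int p)) * of_nat p)" if "1 \<le> k" for k
    using lucas_MV_half_rank[OF setting that half] .
  show "loc_cong p k (lucas_MV P Q (p ^ k * n))
      (of_int (Legendre (lucas_D P Q) (int p)) * of_nat p)" if "1 \<le> k" for k
    using loc_cong_mono[OF p *[OF that]] by simp
next
  have V2: "lucas_V P Q 2 = P\<^sup>2 - 2 * Q" for P Q
    using lucas_V_double[of P Q 1] by (simp add: lucas_V_1)
  have V3: "lucas_V P Q 3 = P * (P\<^sup>2 - 3 * Q)" for P Q
    by (simp add: numeral_3_eq_3 lucas_V_rec power2_eq_square algebra_simps)
  have V6: "lucas_V P Q 6 = (lucas_V P Q 3)\<^sup>2 - 2 * Q ^ 3" for P Q
    using lucas_V_double[of P Q 3] by simp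
  \<comment> \<open>\<open>M_2 = P - 2 Q / P\<close> with \<open>Q\<close> odd is 2-integral only if
    \<open>P\<close> has a single factor 2: \<open>P = 2\<close> gives 3, while \<open>P = 4\<close>
    gives \<open>9 / 2\<close>.\<close>
  have "lucas_setting 2 (- 1) 2 1" "case_i 2 (- 1) 2 1 1"
    by (auto intro!: lucas_setting_positive simp: case_i_def lucas_D_def)
  moreover have "lucas_MV 2 (- 1) (2 ^ 1 * 1) \<in> loc_ring 2"
    using of_int_in_loc_ring[OF two_is_prime_nat, of 3] by (simp add: lucas_MV_2 V2)
  ultimately show "\<exists>P Q p n k. lucas_setting P Q p n \<and> case_i P Q p n k \<and>
        lucas_MV P Q (p ^ k * n) \<in> loc_ring p" by blast
  have "lucas_setting 4 (- 1) 2 1" "case_i 4 (- 1) 2 1 1"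
    by (auto intro!: lucas_setting_positive simp: case_i_def lucas_D_def)
  moreover have "lucas_MV 4 (- 1) (2 ^ 1 * 1) \<notin> loc_ring 2"
    using fraction_not_in_loc_ring[OF two_is_prime_nat, of 9 1] by (simp add: lucas_MV_2 V2)
  ultimately show "\<exists>P Q p n k. lucas_setting P Q p n \<and> case_i P Q p n k \<and>
        lucas_MV P Q (p ^ k * n) \<notin> loc_ring p" by blast
  \<comment> \<open>In case (ii) the power of 2 in \<open>V_3\<close> decides: for
    \<open>Q = -3\<close> one has \<open>V_3 = 10\<close> and \<open>M_6 = 11 / 5\<close>; for
    \<open>Q = -1\<close>, the classical Lucas numbers, \<open>V_3 = 4\<close> and
    \<open>M_6 = 3 / 2\<close>.\<close>
  have "lucas_setting 1 (- 3) 2 3" "case_ii 1 (- 3) 2 3 1"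
    by (auto intro!: lucas_setting_positive simp: case_ii_def lucas_D_def)
  moreover have "lucas_MV 1 (- 3) (2 ^ 1 * 3) \<in> loc_ring 2"
  proof -
    have "(11 / 5 :: rat) = of_int 11 / of_int 5" "\<not> int 2 dvd 5" by simp_all
    then have "(11 / 5 :: rat) \<in> loc_ring 2"
      using loc_ring_iff[OF two_is_prime_nat] by blast
    then show ?thesis by (simp add: lucas_MV_6 V2 V3 V6)
  qed
  ultimately show "\<exists>P Q p n k. lucas_setting P Q p n \<and> case_ii P Q p n k \<and>
        lucas_MV P Q (p ^ k * n) \<in> loc_ring p" by blast
  have "lucas_setting 1 (- 1) 2 3" "case_ii 1 (- 1) 2 3 1"
    by (auto intro!: lucas_setting_positive simp: case_ii_def lucas_D_def)
  moreover have "lucas_MV 1 (- 1) (2 ^ 1 * 3) \<notin> loc_ring 2"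
    using fraction_not_in_loc_ring[OF two_is_prime_nat, of 3 1] by (simp add: lucas_MV_6 V2 V3 V6)
  ultimately show "\<exists>P Q p n k. lucas_setting P Q p n \<and> case_ii P Q p n k \<and>
        lucas_MV P Q (p ^ k * n) \<notin> loc_ring p" by blast
qed

end
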